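(* Let $(\boldsymbol{X}_1,Y_1),\dots,(\boldsymbol{X}_n,Y_n)$ be independent and identically distributed copies of $(\boldsymbol{X},Y)$ following the logistic regression model, let $\boldsymbol{\beta}_0\in\mathbb{R}^q$, and consider testing $H_0:\boldsymbol{\beta}=\boldsymbol{\beta}_0$ versus $H_1:\boldsymbol{\beta}\neq\boldsymbol{\beta}_0$. Under $H_0$ and conditions C1--C9 listed in the context, the empirical phi-divergence test statistic $$T_n^{\phi}(\boldsymbol{\beta}_0)=\frac{2n}{\phi''(1)}d_\phi(\boldsymbol{u},\boldsymbol{p}(\boldsymbol{\beta}_0))=\frac{2}{\phi''(1)}\sum_{i=1}^n \frac{1}{1+\boldsymbol{t}^T(\boldsymbol{\beta}_0)\boldsymbol{g}(\boldsymbol{X}_i,Y_i,\boldsymbol{\beta}_0)}\,\phi\left(1+\boldsymbol{t}^T(\boldsymbol{\beta}_0)\boldsymbol{g}(\boldsymbol{X}_i,Y_i,\boldsymbol{\beta}_0)\right)$$ satisfies $$T_n^{\phi}(\boldsymbol{\beta}_0)\ \xrightarrow[n\to\infty]{\ \mathcal L\ }\ \chi^2_q\qquad\text{for all }\phi\in\Phi,$$ where $\chi^2_q$ is the chi-square distribution with $q$ degrees of freedom.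
   Context: Model. $\boldsymbol{X}$ is a $q$-dimensional explanatory random vector and $Y\in\{0,1\}$. The logistic regression model with parameter $\boldsymbol{\beta}\in\mathbb{R}^q$ means that $\Pr(Y_i=1)=\pi(\boldsymbol{x}_i^T\boldsymbol{\beta})$ given $\boldsymbol{X}_i=\boldsymbol{x}_i$, with $\pi(s)=e^s/(1+e^s)$. The $n\times q$ design matrix with rows $\boldsymbol{X}_i^T$ is assumed to have rank $q$. Put $\boldsymbol{g}(\boldsymbol{x},y,\boldsymbol{\beta})=\boldsymbol{x}\,(y-\pi(\boldsymbol{x}^T\boldsymbol{\beta}))\in\mathbb{R}^q$. Empirical weights. For a parameter vector $\boldsymbol{\beta}$, $\boldsymbol{t}(\boldsymbol{\beta})\in\mathbb{R}^q$ is the solution (unique under C2 and C3) of $$\frac1n\sum_{i=1}^n\frac{\boldsymbol{g}(\boldsymbol{X}_i,Y_i,\boldsymbol{\beta})}{1+\boldsymbol{t}^T(\boldsymbol{\beta})\boldsymbol{g}(\boldsymbol{X}_i,Y_i,\boldsymbol{\beta})}=\boldsymbol{0}_q,\qquad 1+\boldsymbol{t}^T(\boldsymbol{\beta})\boldsymbol{g}(\boldsymbol{X}_i,Y_i,\boldsymbol{\beta})\ge \tfrac1n\ \ (i=1,\dots,n).$$ Put $p_i(\boldsymbol{\beta})=\frac1n\,\frac{1}{1+\boldsymbol{t}^T(\boldsymbol{\beta})\boldsymbol{g}(\boldsymbol{X}_i,Y_i,\boldsymbol{\beta})}$, $\boldsymbol{p}(\boldsymbol{\beta})=(p_1(\boldsymbol{\beta}),\dots,p_n(\boldsymbol{\beta}))^T$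 and $\boldsymbol{u}=(1/n,\dots,1/n)^T$. Divergences. $\Phi^*$ is the class of all twice differentiable convex functions $\phi:\mathbb{R}^+\to\mathbb{R}$ with $\phi(1)=0$, $\phi''(1)>0$, $0\phi(0/0)=0$ and $0\phi(p/0)=p\lim_{u\to\infty}\phi(u)/u$; $\Phi=\{\phi\in\Phi^*:\phi'(1)=0\}$. The $\phi$-divergence of probability vectors is $d_\phi(\boldsymbol{p},\boldsymbol{q})=\sum_{i=1}^n q_i\phi(p_i/q_i)$. Conditions (the true parameter is $\boldsymbol{\beta}_0$; where no value is specified, $\boldsymbol{\beta}$ is the parameter vector under consideration): C1: the true parameter $\boldsymbol{\beta}_0$ is the only solution of $E[\boldsymbol{g}(\boldsymbol{X},Y,\boldsymbol{\beta})]=\boldsymbol{0}_q$. C2: the null vector is contained in the convex hull of $\boldsymbol{g}(\boldsymbol{X}_i,Y_i,\boldsymbol{\beta})$, $i=1,\dots,n$. C3: the matrix $\sum_{i=1}^n\boldsymbol{g}(\boldsymbol{X}_i,Y_i,\boldsymbol{\beta})\boldsymbol{g}(\boldsymbol{X}_i,Y_i,\boldsymbol{\beta})^T$ is positive definite. C4: the matrix $E[\boldsymbol{g}(\boldsymbol{X}_i,Y_i,\boldsymbol{\beta})\boldsymbol{g}^T(\boldsymbol{X}_i,Y_i,\boldsymbol{\beta})]$ is positive definite. C5: $\partial\boldsymbol{g}(\boldsymbol{X}_i,Y_i,\boldsymbol{\beta})/\partial\boldsymbol{\beta}$ is continuous in a neighborhood of the true parameter. C6: $\|\partial\boldsymbol{g}(\boldsymbol{X}_i,Y_i,\boldsymbol{\beta})/\partial\boldsymbol{\beta}\|$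 and $\|\boldsymbol{g}(\boldsymbol{X}_i,Y_i,\boldsymbol{\beta})\|^3$ are bounded by some integrable function $G_1(\boldsymbol{X}_i,Y_i)$ in a neighborhood of the true parameter. C7: the rank of $E[\partial\boldsymbol{g}(\boldsymbol{X}_i,Y_i,\boldsymbol{\beta})/\partial\boldsymbol{\beta}]$ is $q$. C8: $\partial^2\boldsymbol{g}(\boldsymbol{X}_i,Y_i,\boldsymbol{\beta})/\partial\boldsymbol{\beta}\,\partial\boldsymbol{\beta}^T$ is continuous in a neighborhood of the true parameter. C9: $\|\partial^2\boldsymbol{g}(\boldsymbol{X}_i,Y_i,\boldsymbol{\beta})/\partial\boldsymbol{\beta}\,\partial\boldsymbol{\beta}^T\|$ is bounded by some integrable function $G_2(\boldsymbol{X}_i,Y_i)$ in a neighborhood of the true parameter. *)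

theory Defs
  imports "HOL-Probability.Probability"
begin

definition logistic :: "real \<Rightarrow> real" where
  "logistic s = exp s / (1 + exp s)"

definition score :: "real^'q \<Rightarrow> real \<Rightarrow> real^'q \<Rightarrow> real^'q" where
  "score x y \<beta> = (y - logistic (x \<bullet> \<beta>)) *\<^sub>R x"

definition logistic_model ::
  "'a measure \<Rightarrow> ('a \<Rightarrow> real^'q) \<Rightarrow> ('a \<Rightarrow> real) \<Rightarrow> real^'q \<Rightarrow> bool" where
  "logistic_model M X Y \<beta> \<longleftrightarrow>
     X \<in> borel_measurable M \<and> Y \<in> borel_measurable M \<and>
     (\<forall>\<omega>\<in>space M. Y \<omega> \<in> {0, 1}) \<and>
     (AE \<omega> in M. real_cond_exp M (vimage_algebra (space M) X borel)
                    (indicator {\<omega>\<in>space M. Y \<omega> = 1}) \<omega> = logistic (X \<omega> \<bullet> \<beta>))"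

definition iid_copies ::
  "'a measure \<Rightarrow> ('a \<Rightarrow> real^'q) \<Rightarrow> ('a \<Rightarrow> real) \<Rightarrow>
   (nat \<Rightarrow> 'a \<Rightarrow> real^'q) \<Rightarrow> (nat \<Rightarrow> 'a \<Rightarrow> real) \<Rightarrow> bool" where
  "iid_copies M X Y Xs Ys \<longleftrightarrow>
     prob_space.indep_vars M (\<lambda>_. borel) (\<lambda>i \<omega>. (Xs i \<omega>, Ys i \<omega>)) UNIV \<and>
     (\<forall>i. distr M borel (\<lambda>\<omega>. (Xs i \<omega>, Ys i \<omega>)) = distr M borel (\<lambda>\<omega>. (X \<omega>, Y \<omega>)))"

subsection \<open>Empirical weights\<close>

text \<open>A sample of size \<open>n\<close> is given by the values \<open>xs i\<close>, \<open>ys i\<close> for \<open>i < n\<close>, so indices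
  run over \<open>0, \<dots>, n - 1\<close>.\<close>

definition el_equation ::
  "nat \<Rightarrow> (nat \<Rightarrow> real^'q) \<Rightarrow> (nat \<Rightarrow> real) \<Rightarrow> real^'q \<Rightarrow> real^'q \<Rightarrow> bool" where
  "el_equation n xs ys \<beta> t \<longleftrightarrow>
     (1 / real n) *\<^sub>R (\<Sum>i<n. (1 / (1 + t \<bullet> score (xs i) (ys i) \<beta>)) *\<^sub>R score (xs i) (ys i) \<beta>) = 0 \<and>
     (\<forall>i<n. 1 + t \<bullet> score (xs i) (ys i) \<beta> \<ge> 1 / real n)"

text \<open>For samples on which the equation has no solution, or several, the multiplier is set
  to \<open>0\<close>, i.e. the empirical weights are uniform. This is a convention; it only serves to make
  the multiplier a total (and measurable) function of the sample.\<close>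

definition el_multiplier ::
  "nat \<Rightarrow> (nat \<Rightarrow> real^'q) \<Rightarrow> (nat \<Rightarrow> real) \<Rightarrow> real^'q \<Rightarrow> real^'q" where
  "el_multiplier n xs ys \<beta> =
     (if \<exists>!t. el_equation n xs ys \<beta> t then (THE t. el_equation n xs ys \<beta> t) else 0)"

definition el_weight ::
  "nat \<Rightarrow> (nat \<Rightarrow> real^'q) \<Rightarrow> (nat \<Rightarrow> real) \<Rightarrow> real^'q \<Rightarrow> nat \<Rightarrow> real" where
  "el_weight n xs ys \<beta> i =
     1 / real n * (1 / (1 + el_multiplier n xs ys \<beta> \<bullet> score (xs i) (ys i) \<beta>))"

subsection \<open>Phi-divergences\<close>

text \<open>The functions in the class are only constrained on the open half-line. The conventions
  for zero denominators are part of the divergence below.\<close>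

definition Phi_star :: "(real \<Rightarrow> real) set" where
  "Phi_star = {\<phi>. (\<forall>x>0. \<phi> differentiable (at x)) \<and> (\<forall>x>0. deriv \<phi> differentiable (at x)) \<and>
                   convex_on {0<..} \<phi> \<and> \<phi> 1 = 0 \<and> deriv (deriv \<phi>) 1 > 0}"

definition Phi :: "(real \<Rightarrow> real) set" where
  "Phi = {\<phi> \<in> Phi_star. deriv \<phi> 1 = 0}"

text \<open>The limit of \<open>\<phi> u / u\<close> may be infinite, so the divergence is extended-real valued. For
  \<open>p = q = 0\<close> the first branch is \<open>0\<close>, since \<open>0 * \<infinity> = 0\<close> in \<^typ>\<open>ereal\<close>.\<close>

definition phi_term :: "(real \<Rightarrow> real) \<Rightarrow> real \<Rightarrow> real \<Rightarrow> ereal" where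
  "phi_term \<phi> p q =
     (if q = 0 then ereal p * Lim at_top (\<lambda>u. ereal (\<phi> u / u)) else ereal (q * \<phi> (p / q)))"

definition phi_divergence ::
  "nat \<Rightarrow> (real \<Rightarrow> real) \<Rightarrow> (nat \<Rightarrow> real) \<Rightarrow> (nat \<Rightarrow> real) \<Rightarrow> ereal" where
  "phi_divergence n \<phi> p q = (\<Sum>i<n. phi_term \<phi> (p i) (q i))"

text \<open>All empirical weights are positive, so the divergence converted to a real number here is
  finite.\<close>

definition phi_statistic ::
  "(real \<Rightarrow> real) \<Rightarrow> nat \<Rightarrow> (nat \<Rightarrow> real^'q) \<Rightarrow> (nat \<Rightarrow> real) \<Rightarrow> real^'q \<Rightarrow> real" where
  "phi_statistic \<phi> n xs ys \<beta> =
     2 * real n / deriv (deriv \<phi>) 1 *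
     real_of_ereal (phi_divergence n \<phi> (\<lambda>_. 1 / real n) (el_weight n xs ys \<beta>))"

text \<open>The law of a sum of squares of \<open>k\<close> independent standard normal variables.\<close>

definition chi_square_distribution :: "nat \<Rightarrow> real measure" where
  "chi_square_distribution k =
     distr (\<Pi>\<^sub>M i\<in>{..<k}. std_normal_distribution) borel (\<lambda>z. \<Sum>i<k. (z i)\<^sup>2)"

subsection \<open>Regularity conditions\<close>

definition pos_definite :: "real^'q^'q \<Rightarrow> bool" where
  "pos_definite A \<longleftrightarrow> transpose A = A \<and> (\<forall>v. v \<noteq> 0 \<longrightarrow> v \<bullet> (A *v v) > 0)"

definition outer :: "real^'q \<Rightarrow> real^'q^'q" where
  "outer v = (\<chi> i j. v $ i * v $ j)"

text \<open>\<open>score_deriv x y \<beta> $ k $ i\<close> is the derivative of the \<open>k\<close>-th component of the score with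
  respect to \<open>\<beta> $ i\<close>, and \<open>score_deriv2 x y \<beta> $ k $ i $ j\<close> is the second derivative of that component
  with respect to \<open>\<beta> $ i\<close> and \<open>\<beta> $ j\<close>. The norms of these arrays are the Euclidean ones.\<close>

definition score_deriv :: "real^'q \<Rightarrow> real \<Rightarrow> real^'q \<Rightarrow> real^'q^'q" where
  "score_deriv x y \<beta> = jacobian (score x y) (at \<beta>)"

definition score_deriv2 :: "real^'q \<Rightarrow> real \<Rightarrow> real^'q \<Rightarrow> real^'q^'q^'q" where
  "score_deriv2 x y \<beta> = (\<chi> k. jacobian (\<lambda>b. score_deriv x y b $ k) (at \<beta>))"

text \<open>The conditions on a random sample are events; they are required with probability tending
  to \<open>1\<close>. Requiring them almost surely for every \<open>n\<close> would be contradictory (take \<open>n = 1\<close>).\<close>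

definition tending_to_certainty :: "'a measure \<Rightarrow> (nat \<Rightarrow> 'a \<Rightarrow> bool) \<Rightarrow> bool" where
  "tending_to_certainty M P \<longleftrightarrow> (\<lambda>n. measure M {\<omega>\<in>space M. P n \<omega>}) \<longlonglongrightarrow> 1"

text \<open>The set of rows of the design matrix spans a space of dimension \<open>q\<close>.\<close>

definition full_rank_design :: "nat \<Rightarrow> (nat \<Rightarrow> real^'q) \<Rightarrow> bool" where
  "full_rank_design n xs \<longleftrightarrow> dim (xs ` {..<n}) = CARD('q)"

text \<open>Integrability is part of being a root, because the Bochner integral of a non-integrable
  function is \<open>0\<close>.\<close>

definition cond_C1 ::
  "'a measure \<Rightarrow> ('a \<Rightarrow> real^'q) \<Rightarrow> ('a \<Rightarrow> real) \<Rightarrow> real^'q \<Rightarrow> bool" where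
  "cond_C1 M X Y \<beta>0 \<longleftrightarrow>
     (\<forall>\<beta>. (integrable M (\<lambda>\<omega>. score (X \<omega>) (Y \<omega>) \<beta>) \<and>
           integral\<^sup>L M (\<lambda>\<omega>. score (X \<omega>) (Y \<omega>) \<beta>) = 0) \<longleftrightarrow> \<beta> = \<beta>0)"

definition cond_C2 :: "nat \<Rightarrow> (nat \<Rightarrow> real^'q) \<Rightarrow> (nat \<Rightarrow> real) \<Rightarrow> real^'q \<Rightarrow> bool" where
  "cond_C2 n xs ys \<beta> \<longleftrightarrow> 0 \<in> convex hull ((\<lambda>i. score (xs i) (ys i) \<beta>) ` {..<n})"

definition cond_C3 :: "nat \<Rightarrow> (nat \<Rightarrow> real^'q) \<Rightarrow> (nat \<Rightarrow> real) \<Rightarrow> real^'q \<Rightarrow> bool" where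
  "cond_C3 n xs ys \<beta> \<longleftrightarrow> pos_definite (\<Sum>i<n. outer (score (xs i) (ys i) \<beta>))"

definition cond_C4 ::
  "'a measure \<Rightarrow> ('a \<Rightarrow> real^'q) \<Rightarrow> ('a \<Rightarrow> real) \<Rightarrow> real^'q \<Rightarrow> bool" where
  "cond_C4 M X Y \<beta> \<longleftrightarrow>
     integrable M (\<lambda>\<omega>. outer (score (X \<omega>) (Y \<omega>) \<beta>)) \<and>
     pos_definite (integral\<^sup>L M (\<lambda>\<omega>. outer (score (X \<omega>) (Y \<omega>) \<beta>)))"

definition cond_C5 ::
  "'a measure \<Rightarrow> ('a \<Rightarrow> real^'q) \<Rightarrow> ('a \<Rightarrow> real) \<Rightarrow> real^'q \<Rightarrow> bool" where
  "cond_C5 M X Y \<beta>0 \<longleftrightarrow>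
     (\<exists>U. open U \<and> \<beta>0 \<in> U \<and>
       (AE \<omega> in M. (\<forall>\<beta>\<in>U. score (X \<omega>) (Y \<omega>) differentiable (at \<beta>)) \<and>
                   continuous_on U (score_deriv (X \<omega>) (Y \<omega>))))"

definition cond_C6 ::
  "'a measure \<Rightarrow> ('a \<Rightarrow> real^'q) \<Rightarrow> ('a \<Rightarrow> real) \<Rightarrow> real^'q \<Rightarrow> bool" where
  "cond_C6 M X Y \<beta>0 \<longleftrightarrow>
     (\<exists>U G1. open U \<and> \<beta>0 \<in> U \<and> integrable M (\<lambda>\<omega>. G1 (X \<omega>) (Y \<omega>)) \<and>
       (AE \<omega> in M. \<forall>\<beta>\<in>U. norm (score_deriv (X \<omega>) (Y \<omega>) \<beta>) \<le> (G1 (X \<omega>) (Y \<omega>) :: real) \<and>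
                           norm (score (X \<omega>) (Y \<omega>) \<beta>) ^ 3 \<le> G1 (X \<omega>) (Y \<omega>)))"

definition cond_C7 ::
  "'a measure \<Rightarrow> ('a \<Rightarrow> real^'q) \<Rightarrow> ('a \<Rightarrow> real) \<Rightarrow> real^'q \<Rightarrow> bool" where
  "cond_C7 M X Y \<beta> \<longleftrightarrow>
     integrable M (\<lambda>\<omega>. score_deriv (X \<omega>) (Y \<omega>) \<beta>) \<and>
     rank (integral\<^sup>L M (\<lambda>\<omega>. score_deriv (X \<omega>) (Y \<omega>) \<beta>)) = CARD('q)"

definition cond_C8 ::
  "'a measure \<Rightarrow> ('a \<Rightarrow> real^'q) \<Rightarrow> ('a \<Rightarrow> real) \<Rightarrow> real^'q \<Rightarrow> bool" where
  "cond_C8 M X Y \<beta>0 \<longleftrightarrow>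
     (\<exists>U. open U \<and> \<beta>0 \<in> U \<and>
       (AE \<omega> in M. (\<forall>\<beta>\<in>U. score_deriv (X \<omega>) (Y \<omega>) differentiable (at \<beta>)) \<and>
                   continuous_on U (score_deriv2 (X \<omega>) (Y \<omega>))))"

definition cond_C9 ::
  "'a measure \<Rightarrow> ('a \<Rightarrow> real^'q) \<Rightarrow> ('a \<Rightarrow> real) \<Rightarrow> real^'q \<Rightarrow> bool" where
  "cond_C9 M X Y \<beta>0 \<longleftrightarrow>
     (\<exists>U G2. open U \<and> \<beta>0 \<in> U \<and> integrable M (\<lambda>\<omega>. G2 (X \<omega>) (Y \<omega>)) \<and>
       (AE \<omega> in M. \<forall>\<beta>\<in>U. norm (score_deriv2 (X \<omega>) (Y \<omega>) \<beta>) \<le> (G2 (X \<omega>) (Y \<omega>) :: real)))"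

end

theory Submission
  imports Defs
begin

text \<open>The scores \<open>g\<^sub>i\<close> at the true parameter are independent, identically distributed and centred,
  with positive definite covariance \<open>A\<close>. Choosing \<open>B\<close> with \<open>B\<^sup>T A B = I\<close> and putting
  \<open>a\<^sub>i = B\<^sup>T g\<^sub>i / \<surd>n\<close>, one has \<open>\<Sum>\<^sub>i a\<^sub>i a\<^sub>i\<^sup>T \<rightarrow> I\<close> and \<open>max\<^sub>i \<bar>a\<^sub>i\<bar> \<rightarrow> 0\<close> in probability, while
  \<open>V\<^sub>n = \<Sum>\<^sub>i a\<^sub>i\<close> stays bounded in probability. On such samples the concave function
  \<open>\<Sum>\<^sub>i ln (1 + \<theta> \<bullet> a\<^sub>i)\<close> has a critical point \<open>\<theta> \<approx> V\<^sub>n\<close>, which is the empirical likelihood multiplier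
  in the new coordinates, and a second-order expansion of \<open>\<phi>\<close> at \<open>1\<close> shows that the statistic differs
  from \<open>(norm V\<^sub>n)\<^sup>2\<close> by a quantity tending to \<open>0\<close> in probability.

  The limit law is identified without a multivariate central limit theorem. For a standard normal
  vector \<open>z\<close> independent of the sample, \<open>exp (- s\<^sup>2 (norm V\<^sub>n)\<^sup>2 / 2)\<close> is the mean of \<open>exp (\<i> s z \<bullet> V\<^sub>n)\<close>
  over \<open>z\<close>, so that the one-dimensional theorem and dominated convergence give the limits of the
  Laplace transforms; and at the integers these determine weak convergence on the half-line.\<close>

section \<open>Measurable selection of unique zeros\<close>

text \<open>On a compact set a nonnegative continuous function attains its infimum, so it has a zero
  exactly when its values on a countable dense subset come arbitrarily close to 0. This replaces an
  uncountable existential by countable operations.\<close>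

lemma sets_exists_zero_compact:
  fixes F :: "'b::euclidean_space \<Rightarrow> 'a \<Rightarrow> real"
  assumes K: "compact K"
    and meas: "\<And>t. F t \<in> borel_measurable M"
    and cont: "\<And>\<omega>. \<omega> \<in> space M \<Longrightarrow> continuous_on K (\<lambda>t. F t \<omega>)"
    and nonneg: "\<And>t \<omega>. 0 \<le> F t \<omega>"
  shows "{\<omega> \<in> space M. \<exists>t\<in>K. F t \<omega> = 0} \<in> sets M"
proof -
  obtain D where D: "countable D" "D \<subseteq> K" "K \<subseteq> closure D"
    using separable by blast
  have eq: "(\<exists>t\<in>K. F t \<omega> = 0) \<longleftrightarrow> (\<forall>m::nat. \<exists>t\<in>D. F t \<omega> < 1 / Suc m)" if \<omega>: "\<omega> \<in> space M" for \<omega>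
  proof
    assume "\<exists>t\<in>K. F t \<omega> = 0"
    then obtain t where t: "t \<in> K" "F t \<omega> = 0" by blast
    show "\<forall>m::nat. \<exists>t\<in>D. F t \<omega> < 1 / Suc m"
    proof
      fix m :: nat
      obtain d where d: "d > 0" "\<And>t'. t' \<in> K \<Longrightarrow> dist t' t < d \<Longrightarrow> dist (F t' \<omega>) (F t \<omega>) < 1 / Suc m"
        using cont[OF \<omega>, unfolded continuous_on_iff, THEN bspec, OF t(1), THEN spec, of "1 / Suc m"]
        by auto
      obtain t' where "t' \<in> D" "dist t' t < d"
        using D(3) t(1) d(1) closure_approachable by blast
      then have "dist (F t' \<omega>) (F t \<omega>) < 1 / Suc m"
        using d(2) D(2) by blast
      then show "\<exists>t\<in>D. F t \<omega> < 1 / Suc m"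
        using \<open>t' \<in> D\<close> t(2) by (intro bexI[of _ t']) (auto simp: dist_real_def)
    qed
  next
    assume H: "\<forall>m::nat. \<exists>t\<in>D. F t \<omega> < 1 / Suc m"
    then have "K \<noteq> {}" using D(2) by blast
    then obtain t where t: "t \<in> K" "\<And>t'. t' \<in> K \<Longrightarrow> F t \<omega> \<le> F t' \<omega>"
      using continuous_attains_inf[OF K _ cont[OF \<omega>]] by blast
    have "F t \<omega> \<le> 1 / Suc m" for m :: nat
    proof -
      obtain t' where "t' \<in> D" "F t' \<omega> < 1 / Suc m" using H by blast
      then show ?thesis using t(2)[of t'] D(2) by force
    qed
    then have "F t \<omega> \<le> 0"
      using LIMSEQ_Suc[OF lim_1_over_n[where 'a = real]]
      by (intro LIMSEQ_le_const[of "\<lambda>m. 1 / real (Suc m)"]) auto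
    then show "\<exists>t\<in>K. F t \<omega> = 0" using t(1) nonneg[of t \<omega>] by (intro bexI[of _ t]) auto
  qed
  have "{\<omega> \<in> space M. \<exists>t\<in>K. F t \<omega> = 0} = {\<omega> \<in> space M. \<forall>m::nat. \<exists>t\<in>D. F t \<omega> < 1 / Suc m}"
    using eq by blast
  also have "\<dots> \<in> sets M"
    using D(1) meas by measurable
  finally show ?thesis .
qed

lemma sets_exists_zero_closed:
  fixes F :: "'b::euclidean_space \<Rightarrow> 'a \<Rightarrow> real"
  assumes C: "closed C"
    and meas: "\<And>t. F t \<in> borel_measurable M"
    and cont: "\<And>\<omega>. \<omega> \<in> space M \<Longrightarrow> continuous_on UNIV (\<lambda>t. F t \<omega>)"
    and nonneg: "\<And>t \<omega>. 0 \<le> F t \<omega>"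
  shows "{\<omega> \<in> space M. \<exists>t\<in>C. F t \<omega> = 0} \<in> sets M"
proof -
  have "{\<omega> \<in> space M. \<exists>t\<in>C. F t \<omega> = 0} =
    (\<Union>N::nat. {\<omega> \<in> space M. \<exists>t\<in>C \<inter> cball 0 (real N). F t \<omega> = 0})"
    using real_arch_simple by (force simp: dist_norm)
  also have "\<dots> \<in> sets M"
    by (intro sets.countable_nat_UN image_subsetI sets_exists_zero_compact closed_Int_compact C meas
        continuous_on_subset[OF cont] nonneg) auto
  finally show ?thesis .
qed

text \<open>Failure of uniqueness is again the existence of a zero, now of a sum of two copies on
  pairs kept a positive distance apart. Once uniqueness holds, the zero lies in an open set iff no
  zero lies in its closed complement.\<close>

lemma borel_measurable_unique_zero:
  fixes F :: "'b::euclidean_space \<Rightarrow> 'a \<Rightarrow> real"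
  assumes meas: "\<And>t. F t \<in> borel_measurable M"
    and cont: "\<And>\<omega>. \<omega> \<in> space M \<Longrightarrow> continuous_on UNIV (\<lambda>t. F t \<omega>)"
    and nonneg: "\<And>t \<omega>. 0 \<le> F t \<omega>"
  shows "(\<lambda>\<omega>. if \<exists>!t. F t \<omega> = 0 then THE t. F t \<omega> = 0 else 0) \<in> borel_measurable M" (is "?f \<in> _")
proof -
  let ?G = "\<lambda>p \<omega>. F (fst p) \<omega> + F (snd p) \<omega>"
  \<comment> \<open>The complement of the diagonal is not closed; these closed sets exhaust
    it.\<close>
  let ?D = "\<lambda>m::nat. {p :: 'b \<times> 'b. 1 / Suc m \<le> dist (fst p) (snd p)}"
  let ?N = "\<Union>m::nat. {\<omega> \<in> space M. \<exists>p\<in>?D m. ?G p \<omega> = 0}"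
  let ?E = "\<lambda>C. {\<omega> \<in> space M. \<exists>t\<in>C. F t \<omega> = 0}"
  have E: "?E C \<in> sets M" if "closed C" for C
    by (rule sets_exists_zero_closed[OF that meas cont nonneg])
  have "closed (?D m)" for m
    by (intro closed_Collect_le continuous_intros)
  moreover have "continuous_on UNIV (\<lambda>p. ?G p \<omega>)" if "\<omega> \<in> space M" for \<omega>
    by (intro continuous_on_add continuous_on_compose2[OF cont[OF that]] continuous_intros) auto
  ultimately have "{\<omega> \<in> space M. \<exists>p\<in>?D m. ?G p \<omega> = 0} \<in> sets M" for m
    by (intro sets_exists_zero_closed borel_measurable_add meas add_nonneg_nonneg nonneg)
  then have N: "?N \<in> sets M" by blast
  have N_iff: "\<omega> \<in> ?N \<longleftrightarrow> (\<exists>t t'. t \<noteq> t' \<and> F t \<omega> = 0 \<and> F t' \<omega> = 0)" if "\<omega> \<in> space M" for \<omega>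
  proof
    assume "\<omega> \<in> ?N"
    then obtain m p where p: "1 / Suc m \<le> dist (fst p) (snd p)" "?G p \<omega> = 0" by auto
    have "fst p \<noteq> snd p"
      using p(1) by (metis divide_pos_pos dist_self not_le of_nat_0_less_iff zero_less_Suc zero_less_one)
    then show "\<exists>t t'. t \<noteq> t' \<and> F t \<omega> = 0 \<and> F t' \<omega> = 0"
      using p(2) nonneg[of "fst p" \<omega>] nonneg[of "snd p" \<omega>]
      by (intro exI[of _ "fst p"] exI[of _ "snd p"]) auto
  next
    assume "\<exists>t t'. t \<noteq> t' \<and> F t \<omega> = 0 \<and> F t' \<omega> = 0"
    then obtain t t' where t: "t \<noteq> t'" "F t \<omega> = 0" "F t' \<omega> = 0" by blast
    then obtain m where "inverse (real (Suc m)) < dist t t'"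
      using reals_Archimedean[of "dist t t'"] by auto
    then show "\<omega> \<in> ?N"
      using t that
      by (intro UN_I[of m] CollectI conjI bexI[of _ "(t, t')"]) (simp_all add: inverse_eq_divide)
  qed
  define N where "N = ?N"
  have U: "{\<omega> \<in> space M. \<exists>!t. F t \<omega> = 0} = ?E UNIV - N"
  proof (rule Set.set_eqI)
    fix \<omega>
    show "\<omega> \<in> {\<omega> \<in> space M. \<exists>!t. F t \<omega> = 0} \<longleftrightarrow> \<omega> \<in> ?E UNIV - N"
    proof (cases "\<omega> \<in> space M")
      case True
      then have "\<omega> \<in> ?E UNIV - N \<longleftrightarrow>
          (\<exists>t. F t \<omega> = 0) \<and> \<not> (\<exists>t t'. t \<noteq> t' \<and> F t \<omega> = 0 \<and> F t' \<omega> = 0)"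
        using N_iff[OF True, folded N_def] by simp
      also have "\<dots> \<longleftrightarrow> (\<exists>!t. F t \<omega> = 0)" by metis
      finally show ?thesis using True by simp
    qed simp
  qed
  have "?f -` S \<inter> space M \<in> sets M" if "open S" for S
  proof -
    \<comment> \<open>Without uniqueness the value is the default 0, so that part of the space
      contributes all or nothing according to whether \<open>0 \<in> S\<close>.\<close>
    have f: "?f \<omega> \<in> S \<longleftrightarrow> \<not> ((\<exists>!t. F t \<omega> = 0) \<and> (\<exists>t\<in>-S. F t \<omega> = 0) \<or>
        (0 \<notin> S \<and> \<not> (\<exists>!t. F t \<omega> = 0)))" for \<omega>
    proof (cases "\<exists>!t. F t \<omega> = 0")
      case True
      then obtain t where t: "F t \<omega> = 0" "\<And>t'. F t' \<omega> = 0 \<Longrightarrow> t' = t" by blast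
      then have "(THE t. F t \<omega> = 0) = t" by blast
      moreover have "(\<exists>t\<in>-S. F t \<omega> = 0) \<longleftrightarrow> t \<notin> S" using t by blast
      ultimately show ?thesis using True by simp
    qed simp
    let ?U = "{\<omega> \<in> space M. \<exists>!t. F t \<omega> = 0}"
    have "?f -` S \<inter> space M = space M - (?U \<inter> ?E (- S) \<union> (if 0 \<in> S then {} else space M - ?U))"
      by (rule Set.set_eqI) (simp only: vimage_def Int_iff Diff_iff Un_iff mem_Collect_eq f if_distrib[of "(\<in>) _"]
          empty_iff, argo)
    also have "\<dots> \<in> sets M"
    proof -
      have U_sets: "?U \<in> sets M"
        unfolding U using E[of UNIV] N unfolding N_def by (intro sets.Diff) simp_all
      have "?E (- S) \<in> sets M" using E that by (simp add: closed_def)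
      then show ?thesis using U_sets by (simp add: sets.Diff sets.Un sets.Int)
    qed
    finally show ?thesis .
  qed
  then show ?thesis by (intro borel_measurableI)
qed

section \<open>Orthonormalization with respect to a positive definite matrix\<close>

lemma pos_definite_inner_commute:
  assumes "pos_definite A"
  shows "u \<bullet> (A *v v) = v \<bullet> (A *v u)"
  using assms unfolding pos_definite_def by (metis dot_lmul_matrix inner_commute transpose_matrix_vector)

text \<open>Gram-Schmidt for the inner product \<open>u \<bullet> (A *v v)\<close>.\<close>

lemma pos_definite_orthonormal_family:
  fixes A :: "real^'q^'q"
  assumes A: "pos_definite A" and "finite I" "card I \<le> CARD('q)"
  shows "\<exists>b :: 'q \<Rightarrow> real^'q. \<forall>i\<in>I. \<forall>j\<in>I. b i \<bullet> (A *v b j) = (if i = j then 1 else 0)"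
  using assms(2,3)
proof (induction I)
  case empty
  then show ?case by auto
next
  case (insert k I)
  then obtain b :: "'q \<Rightarrow> real^'q"
    where b: "\<And>i j. i \<in> I \<Longrightarrow> j \<in> I \<Longrightarrow> b i \<bullet> (A *v b j) = (if i = j then 1 else 0)" by force
  \<comment> \<open>\<open>I\<close> has fewer than \<open>CARD('q)\<close> elements, so the vectors
    found so far do not span and a further vector \<open>v\<close> is available.\<close>
  have "dim (b ` I) \<le> card I"
    using dim_le_card[of "b ` I" "b ` I"] card_image_le[of I b] insert(1)
    by (metis dim_le_card' finite_imageI le_trans)
  then have "span (b ` I) \<noteq> UNIV"
    using insert(1,2,4) by (metis card_insert_disjoint dim_UNIV dim_span not_less_eq_eq DIM_cart DIM_real mult.right_neutral)
  then obtain v where v: "v \<notin> span (b ` I)" by blast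
  define u where "u = v - (\<Sum>i\<in>I. (b i \<bullet> (A *v v)) *\<^sub>R b i)"
  have "u \<noteq> 0"
  proof
    assume "u = 0"
    moreover have "(\<Sum>i\<in>I. (b i \<bullet> (A *v v)) *\<^sub>R b i) \<in> span (b ` I)"
      by (intro span_sum span_mul span_base) auto
    ultimately show False using v by (simp add: u_def)
  qed
  then have pos: "u \<bullet> (A *v u) > 0"
    using A unfolding pos_definite_def by blast
  have orth: "b j \<bullet> (A *v u) = 0" if "j \<in> I" for j
  proof -
    have "A *v u = A *v v - (\<Sum>i\<in>I. (b i \<bullet> (A *v v)) *\<^sub>R (A *v b i))"
      unfolding u_def
      by (simp only: matrix_vector_mult_diff_distrib linear_sum[OF matrix_vector_mul_linear] matrix_vector_mult_scaleR)
    then have "b j \<bullet> (A *v u) = b j \<bullet> (A *v v) - (\<Sum>i\<in>I. (b i \<bullet> (A *v v)) * (b j \<bullet> (A *v b i)))"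
      by (simp only: inner_diff_right inner_sum_right inner_scaleR_right)
    also have "(\<Sum>i\<in>I. (b i \<bullet> (A *v v)) * (b j \<bullet> (A *v b i))) = (\<Sum>i\<in>I. if j = i then b i \<bullet> (A *v v) else 0)"
      using that b by (intro sum.cong) auto
    finally show ?thesis
      using that insert(1) by simp
  qed
  let ?c = "u /\<^sub>R sqrt (u \<bullet> (A *v u))"
  have c: "?c \<bullet> (A *v ?c) = 1"
    using pos by (simp add: matrix_vector_mult_scaleR field_simps)
  have c_b: "b j \<bullet> (A *v ?c) = 0" "?c \<bullet> (A *v b j) = 0" if "j \<in> I" for j
    using orth[OF that] pos_definite_inner_commute[OF A, of "b j" u] by (simp_all add: matrix_vector_mult_scaleR)
  have "\<forall>i\<in>insert k I. \<forall>j\<in>insert k I.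
      (b(k := ?c)) i \<bullet> (A *v (b(k := ?c)) j) = (if i = j then 1 else 0)"
    using b c c_b insert(2) by (auto simp del: inner_scaleR_left inner_scaleR_right)
  then show ?case by blast
qed

text \<open>The columns of \<open>B\<close> are an orthonormal basis for the form of
  \<open>A\<close>, and the entries of the product are their mutual inner products.\<close>

lemma pos_definite_congruent_identity:
  fixes A :: "real^'q^'q"
  assumes "pos_definite A"
  obtains B :: "real^'q^'q" where "transpose B ** A ** B = mat 1"
proof -
  obtain b :: "'q \<Rightarrow> real^'q" where b: "\<And>i j. b i \<bullet> (A *v b j) = (if i = j then 1 else 0)"
    using pos_definite_orthonormal_family[OF assms, of UNIV] by auto
  define B :: "real^'q^'q" where "B = (\<chi> i j. b j $ i)"
  have "(transpose B ** A ** B) $ i $ j = b i \<bullet> (A *v b j)" for i j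
    unfolding matrix_mul_assoc[symmetric]
    by (simp add: matrix_matrix_mult_def transpose_def B_def inner_vec_def matrix_vector_mult_def)
  then have "transpose B ** A ** B = mat 1"
    using b by (simp add: vec_eq_iff mat_def)
  then show ?thesis by (rule that)
qed

section \<open>Expansion of the statistic\<close>

lemma Phi_has_derivative: "\<phi> \<in> Phi \<Longrightarrow> 0 < x \<Longrightarrow> (\<phi> has_field_derivative deriv \<phi> x) (at x)"
  by (simp add: Phi_def Phi_star_def DERIV_deriv_iff_real_differentiable)

lemma Phi_continuous_on: "\<phi> \<in> Phi \<Longrightarrow> continuous_on {0<..} \<phi>"
  by (meson DERIV_isCont Phi_has_derivative continuous_at_imp_continuous_on greaterThan_iff)

text \<open>A convex function lies above its tangents, and the tangent at 1 is the horizontal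
  axis.\<close>

lemma Phi_nonneg:
  assumes \<phi>: "\<phi> \<in> Phi" and x: "0 < x"
  shows "0 \<le> \<phi> x"
proof -
  have "convex_on {0<..} \<phi>" using \<phi> by (simp add: Phi_def Phi_star_def)
  then have "\<phi> x - \<phi> 1 \<ge> deriv \<phi> 1 * (x - 1)"
    by (rule convex_on_imp_above_tangent)
      (use x Phi_has_derivative[OF \<phi>, of 1] in
        \<open>simp_all add: interior_open has_field_derivative_at_within connected_Ioi\<close>)
  then show ?thesis using \<phi> by (simp add: Phi_def Phi_star_def)
qed

text \<open>L'Hopital's rule is applied once: the quotient of derivatives is half a difference
  quotient of \<open>deriv \<phi>\<close> at 1, so existence of the second derivative there
  suffices, without continuity. The factor \<open>1 / (1 + x)\<close> tends to 1 and does not affect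
  the limit.\<close>

lemma Phi_Taylor:
  assumes \<phi>: "\<phi> \<in> Phi" and "0 < e"
  shows "\<exists>d>0. \<forall>x. \<bar>x\<bar> < d \<longrightarrow>
    \<bar>2 / deriv (deriv \<phi>) 1 * (1 / (1 + x) * \<phi> (1 + x)) - x\<^sup>2\<bar> \<le> e * x\<^sup>2"
proof -
  define c where "c = deriv (deriv \<phi>) 1"
  have c: "0 < c" and zero: "\<phi> 1 = 0" "deriv \<phi> 1 = 0" and "deriv \<phi> differentiable (at 1)"
    using \<phi> by (auto simp: Phi_def Phi_star_def c_def)
  then have "(deriv \<phi> has_field_derivative c) (at 1)"
    unfolding c_def by (simp add: DERIV_deriv_iff_real_differentiable)
  then have "((\<lambda>h. deriv \<phi> (1 + h) / h) \<longlongrightarrow> c) (at 0)"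
    unfolding DERIV_def by (simp add: zero)
  then have lim': "((\<lambda>h. deriv \<phi> (1 + h) / (2 * h)) \<longlongrightarrow> c / 2) (at 0)"
    using tendsto_divide[OF _ tendsto_const[of "2 :: real"]] by (fastforce simp: field_simps)
  have near: "\<forall>\<^sub>F h in at 0. \<bar>h\<bar> < (1 :: real)"
    by (auto simp: eventually_at dist_real_def intro!: exI[of _ 1])
  have der: "((\<lambda>h. \<phi> (1 + h)) has_field_derivative deriv \<phi> (1 + h)) (at h)" if "\<bar>h\<bar> < 1" for h
    using DERIV_shift[of \<phi> "deriv \<phi> (1 + h)" h 1] Phi_has_derivative[OF \<phi>, of "1 + h"] that
    by (simp add: add.commute)
  have "((\<lambda>h. \<phi> (1 + h)) \<longlongrightarrow> \<phi> (1 + 0)) (at 0)"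
    using DERIV_isCont[OF der[of 0]] by (simp add: isCont_def)
  then have lim0: "((\<lambda>h. \<phi> (1 + h)) \<longlongrightarrow> 0) (at 0)"
    by (simp add: zero)
  have lim: "((\<lambda>h. \<phi> (1 + h) / h\<^sup>2) \<longlongrightarrow> c / 2) (at 0)"
  proof (rule lhopital[OF lim0 _ _ _ _ _ lim'])
    show "((\<lambda>h :: real. h\<^sup>2) \<longlongrightarrow> 0) (at 0)" by (rule tendsto_eq_intros | simp)+
    show "\<forall>\<^sub>F h in at 0. ((\<lambda>h. \<phi> (1 + h)) has_field_derivative deriv \<phi> (1 + h)) (at h)"
      using near by eventually_elim (rule der)
    show "\<forall>\<^sub>F h :: real in at 0. ((\<lambda>h. h\<^sup>2) has_field_derivative 2 * h) (at h)"
      by (intro always_eventually allI) (auto intro!: derivative_eq_intros)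
    show "\<forall>\<^sub>F h :: real in at 0. h\<^sup>2 \<noteq> 0" "\<forall>\<^sub>F h :: real in at 0. 2 * h \<noteq> 0"
      by (simp_all add: eventually_at_filter)
  qed
  have "((\<lambda>h. 2 / c * (1 / (1 + h)) * (\<phi> (1 + h) / h\<^sup>2)) \<longlongrightarrow> 2 / c * (1 / (1 + 0)) * (c / 2)) (at 0)"
    by (intro tendsto_mult[OF _ lim] tendsto_intros) auto
  then have lim1: "((\<lambda>h. 2 / c * (1 / (1 + h)) * (\<phi> (1 + h) / h\<^sup>2)) \<longlongrightarrow> 1) (at 0)"
    using c by simp
  obtain d where d: "d > 0"
      "\<And>h. h \<noteq> 0 \<Longrightarrow> \<bar>h\<bar> < d \<Longrightarrow> \<bar>2 / c * (1 / (1 + h)) * (\<phi> (1 + h) / h\<^sup>2) - 1\<bar> < e"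
    using LIM_D[OF lim1 \<open>0 < e\<close>] by auto
  have "\<bar>2 / c * (1 / (1 + x) * \<phi> (1 + x)) - x\<^sup>2\<bar> \<le> e * x\<^sup>2" if "\<bar>x\<bar> < d" for x
  proof (cases "x = 0")
    case False
    have "2 / c * (1 / (1 + x) * \<phi> (1 + x)) - x\<^sup>2 = (2 / c * (1 / (1 + x)) * (\<phi> (1 + x) / x\<^sup>2) - 1) * x\<^sup>2"
      using False by (simp add: left_diff_distrib)
    then show ?thesis
      using d(2)[OF False that] by (simp only: abs_mult abs_power2) (simp add: mult_right_mono)
  qed (simp add: zero)
  then show ?thesis using d(1) unfolding c_def by blast
qed

section \<open>Solving the equation for the multiplier\<close>

lemma ln_one_plus_le:
  fixes x :: real
  assumes "\<bar>x\<bar> \<le> 1 / 2"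
  shows "ln (1 + x) \<le> x - x\<^sup>2 / 6"
proof -
  let ?f = "\<lambda>x :: real. x - x\<^sup>2 / 6 - ln (1 + x)"
  \<comment> \<open>On the interval from -1/2 to 1/2 this derivative has the sign of
    \<open>y\<close>, so \<open>?f\<close> is smallest at 0, where it vanishes.\<close>
  have f: "(?f has_field_derivative y * (2 - y) / (3 * (1 + y))) (at y)" if "- 1 < y" for y
    using that by (auto intro!: derivative_eq_intros simp: field_simps power2_eq_square)
  have "?f 0 \<le> ?f x"
  proof (cases "0 \<le> x")
    case True
    show ?thesis
    proof (rule DERIV_nonneg_imp_nondecreasing[OF True])
      fix y assume "0 \<le> y" "y \<le> x"
      then show "\<exists>z. (?f has_field_derivative z) (at y) \<and> 0 \<le> z"
        using assms by (intro exI[of _ "y * (2 - y) / (3 * (1 + y))"] conjI f) auto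
    qed
  next
    case False
    then have "x \<le> 0" by simp
    then show ?thesis
    proof (rule DERIV_nonpos_imp_nonincreasing)
      fix y assume "x \<le> y" "y \<le> 0"
      then show "\<exists>z. (?f has_field_derivative z) (at y) \<and> z \<le> 0"
        using assms by (intro exI[of _ "y * (2 - y) / (3 * (1 + y))"] conjI f)
          (auto simp: divide_le_0_iff mult_le_0_iff)
    qed
  qed
  then show ?thesis by simp
qed

text \<open>The equation says that \<open>\<theta>\<close> is a critical point of the concave function
  \<open>\<Sum>\<^sub>i ln (1 + \<theta> \<bullet> a\<^sub>i)\<close>, which is \<open>0\<close> at the origin and negative on the sphere of radius \<open>R\<close>.\<close>

lemma el_equation_solvable:
  fixes a :: "nat \<Rightarrow> 'a::euclidean_space"
  assumes V: "norm (\<Sum>i<n. a i) \<le> K" and R: "0 < R" "12 * K < R"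
    and small: "\<And>i. i < n \<Longrightarrow> norm (a i) * R \<le> 1 / 2"
    and gram: "\<And>v. (norm v)\<^sup>2 / 2 \<le> (\<Sum>i<n. (v \<bullet> a i)\<^sup>2)"
  shows "\<exists>\<theta>. norm \<theta> \<le> R \<and> (\<Sum>i<n. (1 / (1 + \<theta> \<bullet> a i)) *\<^sub>R a i) = 0"
proof -
  define F where "F \<theta> = (\<Sum>i<n. ln (1 + \<theta> \<bullet> a i))" for \<theta>
  have le: "\<bar>\<theta> \<bullet> a i\<bar> \<le> 1 / 2" if "norm \<theta> \<le> R" "i < n" for \<theta> i
  proof -
    have "\<bar>\<theta> \<bullet> a i\<bar> \<le> norm \<theta> * norm (a i)" by (rule Cauchy_Schwarz_ineq2)
    also have "\<dots> \<le> norm (a i) * R"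
      using that(1) by (subst mult.commute) (rule mult_left_mono, simp_all)
    finally show ?thesis using small[OF that(2)] by simp
  qed
  then have pos: "0 < 1 + \<theta> \<bullet> a i" if "norm \<theta> \<le> R" "i < n" for \<theta> i
    using le[OF that] unfolding abs_le_iff by linarith
  have "continuous_on (cball 0 R) F"
    unfolding F_def using pos by (intro continuous_intros) (force simp: dist_norm)
  then obtain \<theta> where \<theta>: "norm \<theta> \<le> R" and max: "\<And>\<theta>'. norm \<theta>' \<le> R \<Longrightarrow> F \<theta>' \<le> F \<theta>"
    using continuous_attains_sup[of "cball 0 R" F] R(1) by (auto simp: dist_norm)
  \<comment> \<open>On the sphere the linear term is at most \<open>R * K\<close> and the quadratic
    one at least \<open>R\<^sup>2 / 12\<close> (1/6 from the logarithm, 1/2 from the Gram bound).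
    With \<open>12 * K < R\<close> this puts \<open>F\<close> below its value 0 at the
    centre.\<close>
  have "norm \<theta> \<noteq> R"
  proof
    assume eq: "norm \<theta> = R"
    have "F \<theta> \<le> (\<Sum>i<n. \<theta> \<bullet> a i - (\<theta> \<bullet> a i)\<^sup>2 / 6)"
      unfolding F_def using le[OF \<theta>] by (intro sum_mono ln_one_plus_le) auto
    also have "\<dots> = \<theta> \<bullet> (\<Sum>i<n. a i) - (\<Sum>i<n. (\<theta> \<bullet> a i)\<^sup>2) / 6"
      by (simp add: sum_subtractf inner_sum_right sum_divide_distrib)
    also have "\<dots> \<le> norm \<theta> * norm (\<Sum>i<n. a i) - (norm \<theta>)\<^sup>2 / 12"
      using gram[of \<theta>] by (intro diff_mono norm_cauchy_schwarz) simp
    also have "\<dots> \<le> R * K - R\<^sup>2 / 12"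
      unfolding eq using V R(1) by (intro diff_right_mono mult_left_mono) simp_all
    also have "\<dots> = R * (12 * K - R) / 12"
      by (simp add: power2_eq_square algebra_simps)
    also have "\<dots> < 0"
      using R by (simp add: mult_pos_neg)
    also have "0 = F 0" by (simp add: F_def)
    finally show False using max[of 0] R(1) by simp
  qed
  then have "norm \<theta> < R" using \<theta> by simp
  \<comment> \<open>\<open>h\<close> is the gradient of \<open>F\<close> at \<open>\<theta>\<close>,
    so the derivative of \<open>F\<close> along \<open>h\<close> is \<open>h \<bullet> h\<close>,
    and at an interior maximum it vanishes.\<close>
  define h where "h = (\<Sum>i<n. (1 / (1 + \<theta> \<bullet> a i)) *\<^sub>R a i)"
  have der: "((\<lambda>s. F (\<theta> + s *\<^sub>R h)) has_real_derivative (\<Sum>i<n. (h \<bullet> a i) / (1 + \<theta> \<bullet> a i))) (at 0)"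
    unfolding F_def inner_add_left inner_scaleR_left
    using pos[OF \<theta>] by (intro DERIV_sum) (auto intro!: derivative_eq_intros)
  \<comment> \<open>Steps shorter than \<open>d\<close> along \<open>h\<close> stay in the ball;
    adding 1 to \<open>norm h\<close> keeps the denominator positive.\<close>
  define d where "d = (R - norm \<theta>) / (1 + norm h)"
  have "0 < d" using \<open>norm \<theta> < R\<close> by (simp add: d_def add_pos_nonneg)
  moreover have "F (\<theta> + s *\<^sub>R h) \<le> F (\<theta> + 0 *\<^sub>R h)" if "\<bar>0 - s\<bar> < d" for s
  proof -
    have "norm (\<theta> + s *\<^sub>R h) \<le> norm \<theta> + \<bar>s\<bar> * norm h"
      using norm_triangle_ineq[of \<theta> "s *\<^sub>R h"] by simp
    also have "\<bar>s\<bar> * norm h \<le> d * (1 + norm h)"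
      using that by (intro mult_mono) auto
    also have "d * (1 + norm h) = R - norm \<theta>"
      using norm_ge_zero[of h] unfolding d_def by (intro nonzero_eq_divide_eq[THEN iffD1]) linarith+
    finally show ?thesis using max[of "\<theta> + s *\<^sub>R h"] by simp
  qed
  ultimately have "(\<Sum>i<n. (h \<bullet> a i) / (1 + \<theta> \<bullet> a i)) = 0"
    by (intro DERIV_local_max[OF der]) auto
  then have "h \<bullet> h = 0"
    by (subst (2) h_def) (simp add: inner_sum_right)
  then show ?thesis using \<theta> by (intro exI[of _ \<theta>]) (simp add: h_def)
qed

text \<open>To first order the solution \<open>\<theta>\<close> is \<open>V = \<Sum>\<^sub>i a\<^sub>i\<close>, and to second order the statistic
  is \<open>\<Sum>\<^sub>i (\<theta> \<bullet> a\<^sub>i)\<^sup>2 \<approx> (norm \<theta>)\<^sup>2\<close>.\<close>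

lemma el_statistic_expansion:
  assumes \<phi>: "\<phi> \<in> Phi" and K: "0 < K" and \<eta>: "0 < \<eta>"
  shows "\<exists>s>0. s < 1 \<and> (\<forall>n. \<forall>a :: nat \<Rightarrow> 'a::euclidean_space.
    norm (\<Sum>i<n. a i) \<le> K \<longrightarrow> (\<forall>i<n. norm (a i) \<le> s) \<longrightarrow>
    (\<forall>v. norm ((\<Sum>i<n. (v \<bullet> a i) *\<^sub>R a i) - v) \<le> s * norm v) \<longrightarrow>
    (\<exists>\<theta>. (\<forall>i<n. 1 / 2 \<le> 1 + \<theta> \<bullet> a i) \<and> (\<Sum>i<n. (1 / (1 + \<theta> \<bullet> a i)) *\<^sub>R a i) = 0 \<and>
      \<bar>2 / deriv (deriv \<phi>) 1 * (\<Sum>i<n. 1 / (1 + \<theta> \<bullet> a i) * \<phi> (1 + \<theta> \<bullet> a i)) - (norm (\<Sum>i<n. a i))\<^sup>2\<bar> \<le> \<eta>))"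
proof -
  \<comment> \<open>Any factor above 12 makes the solvability lemma applicable on the ball of this
    radius.\<close>
  define R where "R = 13 * K"
  have R: "0 < R" "12 * K < R" "K \<le> R" using K by (auto simp: R_def)
  \<comment> \<open>The bound \<open>Q \<le> 2 * R\<^sup>2\<close> below turns this relative Taylor
    error into \<open>\<eta> / 2\<close>.\<close>
  define e where "e = \<eta> / (4 * R\<^sup>2)"
  have "0 < e" using \<eta> R by (simp add: e_def)
  obtain d where d: "d > 0" "\<And>x. \<bar>x\<bar> < d \<Longrightarrow>
      \<bar>2 / deriv (deriv \<phi>) 1 * (1 / (1 + x) * \<phi> (1 + x)) - x\<^sup>2\<bar> \<le> e * x\<^sup>2"
    using Phi_Taylor[OF \<phi> \<open>0 < e\<close>] by blast
  \<comment> \<open>The coefficient of \<open>s\<close> in the bound for \<open>Q\<close> against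
    \<open>(norm ?V)\<^sup>2\<close>: \<open>R\<^sup>2\<close> comes from replacing \<open>Q\<close>
    by \<open>(norm \<theta>)\<^sup>2\<close>, the product from replacing \<open>\<theta>\<close> by
    \<open>?V\<close>.\<close>
  define L where "L = R\<^sup>2 + (R + 4 * R\<^sup>2) * (2 * R)"
  have L: "0 < L" using R(1) unfolding L_def by (intro add_pos_pos mult_pos_pos) simp_all
  \<comment> \<open>The four bounds serve, in order, the lower bound on the quadratic form,
    denominators at least 1/2, the range of the Taylor estimate, and the remaining error
    \<open>\<eta> / 2\<close>.\<close>
  define s where "s = min (min (1 / 2) (1 / (2 * R))) (min (d / (2 * R)) (\<eta> / (2 * L)))"
  have s: "0 < s" "s \<le> 1 / 2" "s * R \<le> 1 / 2" "s * R < d" "s * L \<le> \<eta> / 2"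
  proof -
    show "0 < s" 
      using R(1) d(1) \<eta> L unfolding s_def min_less_iff_conj
      by (intro conjI divide_pos_pos mult_pos_pos) simp_all
    show "s \<le> 1 / 2" unfolding s_def by (rule min.coboundedI1[OF min.cobounded1])
    have "s \<le> 1 / (2 * R)" unfolding s_def by (rule min.coboundedI1[OF min.cobounded2])
    then have "s * (2 * R) \<le> 1" using R(1) by (subst (asm) pos_le_divide_eq) simp_all
    then show "s * R \<le> 1 / 2" by linarith
    have "s \<le> d / (2 * R)" unfolding s_def by (rule min.coboundedI2[OF min.cobounded1])
    then have "s * (2 * R) \<le> d" using R(1) by (subst (asm) pos_le_divide_eq) simp_all
    then show "s * R < d" using d(1) by linarith
    have "s \<le> \<eta> / (2 * L)" unfolding s_def by (rule min.coboundedI2[OF min.cobounded2])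
    then have "s * (2 * L) \<le> \<eta>" using L by (subst (asm) pos_le_divide_eq) simp_all
    then show "s * L \<le> \<eta> / 2" by linarith
  qed
  have main: "\<exists>\<theta>. (\<forall>i<n. 1 / 2 \<le> 1 + \<theta> \<bullet> a i) \<and> (\<Sum>i<n. (1 / (1 + \<theta> \<bullet> a i)) *\<^sub>R a i) = 0 \<and>
      \<bar>2 / deriv (deriv \<phi>) 1 * (\<Sum>i<n. 1 / (1 + \<theta> \<bullet> a i) * \<phi> (1 + \<theta> \<bullet> a i)) - (norm (\<Sum>i<n. a i))\<^sup>2\<bar> \<le> \<eta>"
    if V: "norm (\<Sum>i<n. a i) \<le> K" and small: "\<And>i. i < n \<Longrightarrow> norm (a i) \<le> s"
      and gram: "\<And>v. norm ((\<Sum>i<n. (v \<bullet> a i) *\<^sub>R a i) - v) \<le> s * norm v"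
    for n and a :: "nat \<Rightarrow> 'a"
  proof -
    let ?V = "\<Sum>i<n. a i"
    have quad: "\<bar>(\<Sum>i<n. (v \<bullet> a i)\<^sup>2) - (norm v)\<^sup>2\<bar> \<le> s * (norm v)\<^sup>2" for v
    proof -
      have "(\<Sum>i<n. (v \<bullet> a i)\<^sup>2) - (norm v)\<^sup>2 = v \<bullet> ((\<Sum>i<n. (v \<bullet> a i) *\<^sub>R a i) - v)"
        by (simp add: inner_diff_right inner_sum_right power2_eq_square power2_norm_eq_inner[unfolded power2_eq_square])
      also have "\<bar>\<dots>\<bar> \<le> norm v * norm ((\<Sum>i<n. (v \<bullet> a i) *\<^sub>R a i) - v)"
        by (rule Cauchy_Schwarz_ineq2)
      also have "\<dots> \<le> norm v * (s * norm v)" by (intro mult_left_mono gram) simp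
      finally show ?thesis by (simp add: power2_eq_square ac_simps)
    qed
    have "(norm v)\<^sup>2 / 2 \<le> (\<Sum>i<n. (v \<bullet> a i)\<^sup>2)" for v
    proof -
      have "s * (norm v)\<^sup>2 \<le> 1 / 2 * (norm v)\<^sup>2" by (intro mult_right_mono s(2)) simp
      then show ?thesis using quad[of v] by linarith
    qed
    moreover have "norm (a i) * R \<le> 1 / 2" if "i < n" for i
      using mult_right_mono[OF small[OF that], of R] R s(3) by linarith
    ultimately obtain \<theta> where \<theta>: "norm \<theta> \<le> R" and eq: "(\<Sum>i<n. (1 / (1 + \<theta> \<bullet> a i)) *\<^sub>R a i) = 0"
      using el_equation_solvable[OF V R(1,2)] by blast
    define x where "x i = \<theta> \<bullet> a i" for i
    define Q where "Q = (\<Sum>i<n. (x i)\<^sup>2)"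
    have x_le: "\<bar>x i\<bar> \<le> s * R" if "i < n" for i
    proof -
      have "\<bar>x i\<bar> \<le> norm \<theta> * norm (a i)" unfolding x_def by (rule Cauchy_Schwarz_ineq2)
      also have "\<dots> \<le> R * s" using \<theta> small[OF that] R by (intro mult_mono) auto
      finally show ?thesis by (simp add: mult.commute)
    qed
    have x_half: "1 / 2 \<le> 1 + x i" if "i < n" for i
      using x_le[OF that] s(3) by linarith
    have \<theta>2: "(norm \<theta>)\<^sup>2 \<le> R\<^sup>2" using \<theta> by (simp add: power_mono)
    have Q_\<theta>: "\<bar>Q - (norm \<theta>)\<^sup>2\<bar> \<le> s * R\<^sup>2"
      unfolding Q_def x_def using quad[of \<theta>] mult_left_mono[OF \<theta>2, of s] s(1) by linarith
    have Q: "0 \<le> Q" "Q \<le> 2 * R\<^sup>2"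
    proof -
      show "0 \<le> Q" by (simp add: Q_def sum_nonneg)
      have "s * R\<^sup>2 \<le> 1 * R\<^sup>2" using s(2) by (intro mult_right_mono) auto
      then show "Q \<le> 2 * R\<^sup>2" using Q_\<theta> \<theta>2 by linarith
    qed
    define T where "T = 2 / deriv (deriv \<phi>) 1 * (\<Sum>i<n. 1 / (1 + x i) * \<phi> (1 + x i))"
    have "\<bar>T - Q\<bar> = \<bar>\<Sum>i<n. 2 / deriv (deriv \<phi>) 1 * (1 / (1 + x i) * \<phi> (1 + x i)) - (x i)\<^sup>2\<bar>"
      unfolding Q_def T_def by (simp only: sum_distrib_left sum_subtractf)
    also have "\<dots> \<le> (\<Sum>i<n. e * (x i)\<^sup>2)"
      using x_le s(4) by (intro order_trans[OF sum_abs] sum_mono d) force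
    also have "\<dots> = e * Q" by (simp add: Q_def sum_distrib_left)
    also have "\<dots> \<le> e * (2 * R\<^sup>2)" using Q \<open>0 < e\<close> by (intro mult_left_mono) auto
    also have "\<dots> = \<eta> / 2" using R by (simp add: e_def)
    finally have T_Q: "\<bar>T - Q\<bar> \<le> \<eta> / 2" .
    \<comment> \<open>The remainder of \<open>1 / (1 + x) = 1 - x + x\<^sup>2 / (1 + x)\<close>,
      weighted by the \<open>a i\<close>. It is of order \<open>s\<close>: each \<open>a i\<close>
      has norm at most \<open>s\<close>, and the squares add up to \<open>Q\<close>.\<close>
    define r where "r = (\<Sum>i<n. ((x i)\<^sup>2 / (1 + x i)) *\<^sub>R a i)"
    have "norm r \<le> (\<Sum>i<n. 2 * s * (x i)\<^sup>2)"
      unfolding r_def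
    proof (rule sum_norm_le)
      fix i assume "i \<in> {..<n}"
      then have i: "i < n" by simp
      have "(x i)\<^sup>2 / (1 + x i) \<le> (x i)\<^sup>2 / (1 / 2)"
        using x_half[OF i] by (intro divide_left_mono) auto
      then have "(x i)\<^sup>2 / (1 + x i) * norm (a i) \<le> (x i)\<^sup>2 / (1 / 2) * s"
        using small[OF i] x_half[OF i] by (intro mult_mono) auto
      then show "norm (((x i)\<^sup>2 / (1 + x i)) *\<^sub>R a i) \<le> 2 * s * (x i)\<^sup>2"
        using x_half[OF i] by (simp add: ac_simps)
    qed
    also have "\<dots> = 2 * s * Q" by (simp add: Q_def sum_distrib_left)
    also have "\<dots> \<le> 2 * s * (2 * R\<^sup>2)" using Q s(1) by (intro mult_left_mono) auto
    finally have r: "norm r \<le> 4 * s * R\<^sup>2" by simp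
    \<comment> \<open>By this splitting the equation expresses \<open>?V\<close> as the Gram matrix
      applied to \<open>\<theta>\<close>, minus \<open>r\<close>; the Gram matrix being close to the
      identity, \<open>\<theta>\<close> is close to \<open>?V\<close>.\<close>
    have "0 = (\<Sum>i<n. a i - x i *\<^sub>R a i + ((x i)\<^sup>2 / (1 + x i)) *\<^sub>R a i)"
      unfolding eq[symmetric] x_def[symmetric]
    proof (rule sum.cong)
      fix i assume "i \<in> {..<n}"
      then have "1 + x i \<noteq> 0" using x_half[of i] by auto
      then have "1 / (1 + x i) = 1 - x i + (x i)\<^sup>2 / (1 + x i)"
        by (simp add: field_simps power2_eq_square)
      then show "(1 / (1 + x i)) *\<^sub>R a i = a i - x i *\<^sub>R a i + ((x i)\<^sup>2 / (1 + x i)) *\<^sub>R a i"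
        by (simp add: scaleR_add_left scaleR_diff_left)
    qed simp
    then have "?V - \<theta> = ((\<Sum>i<n. (\<theta> \<bullet> a i) *\<^sub>R a i) - \<theta>) - r"
      by (simp add: sum.distrib sum_subtractf r_def x_def algebra_simps)
    then have "norm (?V - \<theta>) = norm (((\<Sum>i<n. (\<theta> \<bullet> a i) *\<^sub>R a i) - \<theta>) - r)"
      by (rule arg_cong)
    then have "norm (?V - \<theta>) \<le> s * norm \<theta> + 4 * s * R\<^sup>2"
      using norm_triangle_ineq4[of "(\<Sum>i<n. (\<theta> \<bullet> a i) *\<^sub>R a i) - \<theta>" r] gram[of \<theta>] r by linarith
    also have "\<dots> \<le> s * (R + 4 * R\<^sup>2)"
      using mult_left_mono[OF \<theta>, of s] s(1) by (simp add: distrib_left)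
    finally have V_\<theta>: "norm (?V - \<theta>) \<le> s * (R + 4 * R\<^sup>2)" .
    have "\<bar>norm ?V - norm \<theta>\<bar> \<le> s * (R + 4 * R\<^sup>2)"
      by (rule order_trans[OF norm_triangle_ineq3 V_\<theta>])
    moreover have "norm ?V + norm \<theta> \<le> 2 * R" using V \<theta> R(3) by linarith
    ultimately have le: "\<bar>norm ?V - norm \<theta>\<bar> * (norm ?V + norm \<theta>) \<le> (s * (R + 4 * R\<^sup>2)) * (2 * R)"
      by (rule mult_mono) (use s(1) R(1) in \<open>simp_all add: add_nonneg_nonneg\<close>)
    have "\<bar>(norm ?V)\<^sup>2 - (norm \<theta>)\<^sup>2\<bar> = \<bar>norm ?V - norm \<theta>\<bar> * (norm ?V + norm \<theta>)"
      by (simp add: power2_eq_square square_diff_square_factored abs_mult mult.commute)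
    also have "\<dots> \<le> (s * (R + 4 * R\<^sup>2)) * (2 * R)"
      by (rule le)
    finally have "\<bar>(norm ?V)\<^sup>2 - (norm \<theta>)\<^sup>2\<bar> \<le> s * ((R + 4 * R\<^sup>2) * (2 * R))" by (simp add: mult.assoc)
    then have "\<bar>Q - (norm ?V)\<^sup>2\<bar> \<le> s * L"
      unfolding L_def distrib_left[of s] using Q_\<theta> by linarith
    then have "\<bar>T - (norm ?V)\<^sup>2\<bar> \<le> \<eta>"
      using T_Q s(5) by linarith
    with x_half eq show ?thesis
      unfolding x_def T_def by (intro exI[of _ \<theta>] conjI allI impI)
  qed
  show ?thesis
  proof (intro exI[of _ s] conjI allI impI)
    show "0 < s" "s < 1" using s(1,2) by simp_all
    fix n and a :: "nat \<Rightarrow> 'a"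
    assume "norm (\<Sum>i<n. a i) \<le> K" "\<forall>i<n. norm (a i) \<le> s"
      "\<forall>v. norm ((\<Sum>i<n. (v \<bullet> a i) *\<^sub>R a i) - v) \<le> s * norm v"
    then show "\<exists>\<theta>. (\<forall>i<n. 1 / 2 \<le> 1 + \<theta> \<bullet> a i) \<and> (\<Sum>i<n. (1 / (1 + \<theta> \<bullet> a i)) *\<^sub>R a i) = 0 \<and>
      \<bar>2 / deriv (deriv \<phi>) 1 * (\<Sum>i<n. 1 / (1 + \<theta> \<bullet> a i) * \<phi> (1 + \<theta> \<bullet> a i)) - (norm (\<Sum>i<n. a i))\<^sup>2\<bar> \<le> \<eta>"
      by (intro main) blast+
  qed
qed

section \<open>Weak law of large numbers\<close>

lemma integral_eq_of_distr_eq: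
  fixes f :: "'b \<Rightarrow> 'c::{banach, second_countable_topology}"
  assumes "distr M N X = distr M N Y"
    and "X \<in> measurable M N" "Y \<in> measurable M N" "f \<in> borel_measurable N"
  shows "(\<integral>\<omega>. f (X \<omega>) \<partial>M) = (\<integral>\<omega>. f (Y \<omega>) \<partial>M)"
  using assms integral_distr[of X M N f] integral_distr[of Y M N f] by simp

lemma integrable_eq_of_distr_eq:
  fixes f :: "'b \<Rightarrow> 'c::{banach, second_countable_topology}"
  assumes "distr M N X = distr M N Y"
    and "X \<in> measurable M N" "Y \<in> measurable M N" "f \<in> borel_measurable N"
  shows "integrable M (\<lambda>\<omega>. f (X \<omega>)) \<longleftrightarrow> integrable M (\<lambda>\<omega>. f (Y \<omega>))"
  using assms integrable_distr_eq[of X M N f] integrable_distr_eq[of Y M N f] by simp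

lemma measure_eq_of_distr_eq:
  assumes "distr M N X = distr M N Y"
    and "X \<in> measurable M N" "Y \<in> measurable M N" "{x \<in> space N. P x} \<in> sets N"
  shows "measure M {\<omega> \<in> space M. P (X \<omega>)} = measure M {\<omega> \<in> space M. P (Y \<omega>)}"
proof -
  have "measure M {\<omega> \<in> space M. P (Z \<omega>)} = measure (distr M N Z) {x \<in> space N. P x}"
    if "Z \<in> measurable M N" for Z
    using assms(4) that measurable_space[OF that]
    by (subst measure_distr) (auto intro!: arg_cong[where f = "measure M"])
  then show ?thesis using assms by simp
qed

context prob_space
begin

text \<open>In the induction the cross term vanishes because the new variable is centred and
  independent of the partial sum.\<close>

lemma expectation_square_sum_indep:
  fixes X :: "nat \<Rightarrow> 'a \<Rightarrow> real"
  assumes indep: "indep_vars (\<lambda>_. borel) X UNIV"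
    and sq: "\<And>i. integrable M (\<lambda>\<omega>. (X i \<omega>)\<^sup>2)"
    and mean: "\<And>i. expectation (X i) = 0"
  shows "integrable M (\<lambda>\<omega>. (\<Sum>i<n. X i \<omega>)\<^sup>2) \<and>
    expectation (\<lambda>\<omega>. (\<Sum>i<n. X i \<omega>)\<^sup>2) = (\<Sum>i<n. expectation (\<lambda>\<omega>. (X i \<omega>)\<^sup>2))"
proof (induction n)
  case 0
  then show ?case by simp
next
  case (Suc n)
  have meas[measurable]: "X i \<in> borel_measurable M" for i
    using indep unfolding indep_vars_def2 by simp
  have int: "integrable M (X i)" for i
    by (rule square_integrable_imp_integrable[OF meas sq])
  have indep': "indep_var borel (X n) borel (\<lambda>\<omega>. \<Sum>i<n. X i \<omega>)"
    by (rule indep_vars_sum) (use indep in \<open>auto intro: indep_vars_subset\<close>)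
  have int_sum: "integrable M (\<lambda>\<omega>. \<Sum>i<n. X i \<omega>)"
    by (intro Bochner_Integration.integrable_sum int)
  have prod: "integrable M (\<lambda>\<omega>. X n \<omega> * (\<Sum>i<n. X i \<omega>))"
    "expectation (\<lambda>\<omega>. X n \<omega> * (\<Sum>i<n. X i \<omega>)) = 0"
    using indep_var_integrable[OF indep' int int_sum] indep_var_lebesgue_integral[OF indep' int int_sum] mean
    by auto
  have eq: "(\<Sum>i<Suc n. X i \<omega>)\<^sup>2 =
      (\<Sum>i<n. X i \<omega>)\<^sup>2 + (X n \<omega>)\<^sup>2 + 2 * (X n \<omega> * (\<Sum>i<n. X i \<omega>))" for \<omega>
    by (simp add: power2_sum)
  show ?case
    unfolding eq using Suc sq prod by simp
qed

text \<open>Dominated convergence: \<open>n\<close> times the indicator of the event is at most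
  \<open>\<bar>X \<omega>\<bar> / c\<close> and, at each point, eventually 0.\<close>

lemma tail_probability_integrable:
  fixes X :: "'a \<Rightarrow> real"
  assumes int: "integrable M X" and "0 < c"
  shows "(\<lambda>n. real n * prob {\<omega> \<in> space M. c * real n < \<bar>X \<omega>\<bar>}) \<longlonglongrightarrow> 0"
proof -
  have [measurable]: "X \<in> borel_measurable M" using int by simp
  let ?A = "\<lambda>n. {\<omega> \<in> space M. c * real n < \<bar>X \<omega>\<bar>}"
  have "(\<lambda>n. \<integral>\<omega>. real n * indicator (?A n) \<omega> \<partial>M) \<longlonglongrightarrow> (\<integral>\<omega>. 0 \<partial>M)"
  proof (rule integral_dominated_convergence[where w = "\<lambda>\<omega>. \<bar>X \<omega>\<bar> / c"])
    show "integrable M (\<lambda>\<omega>. \<bar>X \<omega>\<bar> / c)" using int by simp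
    show "AE \<omega> in M. (\<lambda>n. real n * indicator (?A n) \<omega> :: real) \<longlonglongrightarrow> 0"
    proof (rule AE_I2)
      fix \<omega>
      obtain N :: nat where N: "\<bar>X \<omega>\<bar> / c < real N" using reals_Archimedean2 by blast
      have "real n * indicator (?A n) \<omega> = (0 :: real)" if "n \<ge> N" for n
      proof -
        have "\<bar>X \<omega>\<bar> / c < real n" using N that by linarith
        then have "\<bar>X \<omega>\<bar> < c * real n" using \<open>0 < c\<close> by (simp add: field_simps)
        then show ?thesis by simp
      qed
      then show "(\<lambda>n. real n * indicator (?A n) \<omega> :: real) \<longlonglongrightarrow> 0"
        by (intro tendsto_eventually eventually_sequentiallyI)
    qed
    show "AE \<omega> in M. norm (real n * indicator (?A n) \<omega> :: real) \<le> \<bar>X \<omega>\<bar> / c" for n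
      using \<open>0 < c\<close> by (intro AE_I2) (auto simp: indicator_def field_simps)
  qed simp_all
  then show ?thesis by simp
qed

text \<open>The integrand is bounded both by \<open>\<bar>X \<omega>\<bar>\<close>, which dominates,
  and by \<open>(X \<omega>)\<^sup>2 / n\<close>, which tends to 0.\<close>

lemma truncated_second_moment:
  fixes X :: "'a \<Rightarrow> real"
  assumes int: "integrable M X"
  shows "(\<lambda>n. expectation (\<lambda>\<omega>. (if \<bar>X \<omega>\<bar> \<le> real n then X \<omega> else 0)\<^sup>2) / real n) \<longlonglongrightarrow> 0"
proof -
  have [measurable]: "X \<in> borel_measurable M" using int by simp
  have "(\<lambda>n. \<integral>\<omega>. (if \<bar>X \<omega>\<bar> \<le> real n then X \<omega> else 0)\<^sup>2 / real n \<partial>M) \<longlonglongrightarrow> (\<integral>\<omega>. 0 \<partial>M)"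
  proof (rule integral_dominated_convergence[where w = "\<lambda>\<omega>. \<bar>X \<omega>\<bar>"])
    show "integrable M (\<lambda>\<omega>. \<bar>X \<omega>\<bar>)" using int by simp
    show "AE \<omega> in M. (\<lambda>n. (if \<bar>X \<omega>\<bar> \<le> real n then X \<omega> else 0)\<^sup>2 / real n) \<longlonglongrightarrow> 0"
    proof (rule AE_I2)
      fix \<omega>
      have "(\<lambda>n. (X \<omega>)\<^sup>2 / real n) \<longlonglongrightarrow> 0" by (rule lim_const_over_n)
      then show "(\<lambda>n. (if \<bar>X \<omega>\<bar> \<le> real n then X \<omega> else 0)\<^sup>2 / real n) \<longlonglongrightarrow> 0"
        by (rule tendsto_sandwich[OF _ _ tendsto_const, rotated 2]) (auto simp: eventually_sequentially)
    qed
    show "AE \<omega> in M. norm ((if \<bar>X \<omega>\<bar> \<le> real n then X \<omega> else 0)\<^sup>2 / real n) \<le> \<bar>X \<omega>\<bar>" for n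
    proof (rule AE_I2)
      fix \<omega>
      have "(X \<omega>)\<^sup>2 \<le> real n * \<bar>X \<omega>\<bar>" if "\<bar>X \<omega>\<bar> \<le> real n"
        using mult_right_mono[OF that, of "\<bar>X \<omega>\<bar>"] by (simp add: power2_eq_square)
      then show "norm ((if \<bar>X \<omega>\<bar> \<le> real n then X \<omega> else 0)\<^sup>2 / real n) \<le> \<bar>X \<omega>\<bar>"
        by (cases "n = 0") (auto simp: field_simps)
    qed
  qed simp_all
  then show ?thesis by simp
qed

text \<open>Variables are truncated at the sample size \<open>n\<close>. By a union bound truncation
  changes something with probability at most \<open>n\<close> times a tail probability, and
  Chebyshev's inequality controls the truncated sum through its second moment over \<open>n\<close>.
  A first moment suffices, as is needed for products of coordinates.\<close>

theorem weak_law_of_large_numbers: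
  fixes X :: "nat \<Rightarrow> 'a \<Rightarrow> real"
  assumes indep: "indep_vars (\<lambda>_. borel) X UNIV"
    and distr: "\<And>i. distr M borel (X i) = distr M borel (X 0)"
    and int: "integrable M (X 0)" and "0 < e"
  shows "(\<lambda>n. prob {\<omega> \<in> space M. e < \<bar>(\<Sum>i<n. X i \<omega>) / real n - expectation (X 0)\<bar>}) \<longlonglongrightarrow> 0"
proof -
  have meas[measurable]: "X i \<in> borel_measurable M" for i
    using indep unfolding indep_vars_def2 by simp
  define \<tau> where "\<tau> n x = (if \<bar>x\<bar> \<le> real n then x else 0)" for n :: nat and x :: real
  have \<tau>_meas[measurable]: "\<tau> n \<in> borel_measurable borel" for n
    unfolding \<tau>_def by measurable
  have \<tau>_bound: "\<bar>\<tau> n x\<bar> \<le> real n" for n x by (simp add: \<tau>_def)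
  define m where "m n = expectation (\<lambda>\<omega>. \<tau> n (X 0 \<omega>))" for n
  have m_lim: "m \<longlonglongrightarrow> expectation (X 0)"
    unfolding m_def
  proof (rule integral_dominated_convergence[where w = "\<lambda>\<omega>. \<bar>X 0 \<omega>\<bar>"])
    show "AE \<omega> in M. (\<lambda>n. \<tau> n (X 0 \<omega>)) \<longlonglongrightarrow> X 0 \<omega>"
    proof (rule AE_I2)
      fix \<omega>
      obtain N :: nat where "\<bar>X 0 \<omega>\<bar> < real N" using reals_Archimedean2 by blast
      then show "(\<lambda>n. \<tau> n (X 0 \<omega>)) \<longlonglongrightarrow> X 0 \<omega>"
        by (intro tendsto_eventually eventually_sequentiallyI[of N]) (auto simp: \<tau>_def)
    qed
  qed (use int in \<open>auto simp: \<tau>_def\<close>)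
  have int_\<tau>: "integrable M (\<lambda>\<omega>. \<tau> n (X i \<omega>))" for n i
    by (rule integrable_const_bound[where B = "real n"]) (use \<tau>_bound in auto)
  have int_\<tau>2: "integrable M (\<lambda>\<omega>. (\<tau> n (X i \<omega>))\<^sup>2)" for n i
    by (rule integrable_const_bound[where B = "(real n)\<^sup>2"])
      (use \<tau>_bound[of n] in \<open>auto simp: abs_le_square_iff[symmetric]\<close>)
  define S where "S n \<omega> = (\<Sum>i<n. \<tau> n (X i \<omega>) - m n)" for n \<omega>
  have S_meas[measurable]: "S n \<in> borel_measurable M" for n unfolding S_def by measurable
  have S_sq: "integrable M (\<lambda>\<omega>. (S n \<omega>)\<^sup>2)"
    "expectation (\<lambda>\<omega>. (S n \<omega>)\<^sup>2) \<le> real n * expectation (\<lambda>\<omega>. (\<tau> n (X 0 \<omega>))\<^sup>2)" for n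
  proof -
    have E: "expectation (\<lambda>\<omega>. f (X i \<omega>)) = expectation (\<lambda>\<omega>. f (X 0 \<omega>))"
      if "f \<in> borel_measurable borel" for f :: "real \<Rightarrow> real" and i
      using that by (intro integral_eq_of_distr_eq[OF distr]) auto
    have "indep_vars (\<lambda>_. borel) (\<lambda>i \<omega>. \<tau> n (X i \<omega>) - m n) UNIV"
      by (rule indep_vars_compose2[OF indep]) measurable
    moreover have "integrable M (\<lambda>\<omega>. (\<tau> n (X i \<omega>) - m n)\<^sup>2)" for i
      unfolding power2_diff using int_\<tau> int_\<tau>2 by simp
    moreover have "expectation (\<lambda>\<omega>. \<tau> n (X i \<omega>) - m n) = 0" for i
      using int_\<tau> E[OF \<tau>_meas, of n i] by (simp add: m_def prob_space)
    ultimately have S: "integrable M (\<lambda>\<omega>. (S n \<omega>)\<^sup>2)"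
      "expectation (\<lambda>\<omega>. (S n \<omega>)\<^sup>2) = (\<Sum>i<n. expectation (\<lambda>\<omega>. (\<tau> n (X i \<omega>) - m n)\<^sup>2))"
      unfolding S_def using expectation_square_sum_indep[of "\<lambda>i \<omega>. \<tau> n (X i \<omega>) - m n" n] by auto
    have "expectation (\<lambda>\<omega>. (\<tau> n (X i \<omega>) - m n)\<^sup>2) \<le> expectation (\<lambda>\<omega>. (\<tau> n (X 0 \<omega>))\<^sup>2)" for i
    proof -
      have "expectation (\<lambda>\<omega>. (\<tau> n (X i \<omega>) - m n)\<^sup>2) = variance (\<lambda>\<omega>. \<tau> n (X 0 \<omega>))"
        unfolding m_def by (intro E) measurable
      also have "\<dots> = expectation (\<lambda>\<omega>. (\<tau> n (X 0 \<omega>))\<^sup>2) - (m n)\<^sup>2"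
        unfolding m_def by (intro variance_eq int_\<tau> int_\<tau>2)
      finally show ?thesis by simp
    qed
    then show "expectation (\<lambda>\<omega>. (S n \<omega>)\<^sup>2) \<le> real n * expectation (\<lambda>\<omega>. (\<tau> n (X 0 \<omega>))\<^sup>2)"
      unfolding S(2) using sum_bounded_above[of "{..<n}" "\<lambda>i. expectation (\<lambda>\<omega>. (\<tau> n (X i \<omega>) - m n)\<^sup>2)"
          "expectation (\<lambda>\<omega>. (\<tau> n (X 0 \<omega>))\<^sup>2)"] by simp
    show "integrable M (\<lambda>\<omega>. (S n \<omega>)\<^sup>2)" by (rule S(1))
  qed
  let ?P = "\<lambda>n. prob {\<omega> \<in> space M. e < \<bar>(\<Sum>i<n. X i \<omega>) / real n - expectation (X 0)\<bar>}"
  let ?a = "\<lambda>n. real n * prob {\<omega> \<in> space M. 1 * real n < \<bar>X 0 \<omega>\<bar>}"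
  \<comment> \<open>Chebyshev's inequality at distance \<open>e / 2\<close>, whence the 4; the other
    \<open>e / 2\<close> covers the gap between the truncated mean \<open>m n\<close> and the true
    mean.\<close>
  let ?b = "\<lambda>n. 4 / e\<^sup>2 * (expectation (\<lambda>\<omega>. (\<tau> n (X 0 \<omega>))\<^sup>2) / real n)"
  have "?a \<longlonglongrightarrow> 0" by (intro tail_probability_integrable int) simp
  moreover have "?b \<longlonglongrightarrow> 0"
    using tendsto_mult_left[OF truncated_second_moment[OF int], of "4 / e\<^sup>2"] by (simp add: \<tau>_def)
  ultimately have ab: "(\<lambda>n. ?a n + ?b n) \<longlonglongrightarrow> 0" by (rule tendsto_add_zero)
  have bound: "?P n \<le> ?a n + ?b n" if "\<bar>m n - expectation (X 0)\<bar> < e / 2" "0 < n" for n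
  proof -
    let ?B = "{\<omega> \<in> space M. real n * (e / 2) \<le> \<bar>S n \<omega>\<bar>}"
    let ?A = "\<lambda>i. {\<omega> \<in> space M. real n < \<bar>X i \<omega>\<bar>}"
    have "{\<omega> \<in> space M. e < \<bar>(\<Sum>i<n. X i \<omega>) / real n - expectation (X 0)\<bar>} \<subseteq> (\<Union>i<n. ?A i) \<union> ?B"
    proof (intro subsetI, rule ccontr)
      fix \<omega> assume \<omega>: "\<omega> \<in> {\<omega> \<in> space M. e < \<bar>(\<Sum>i<n. X i \<omega>) / real n - expectation (X 0)\<bar>}"
        and not: "\<omega> \<notin> (\<Union>i<n. ?A i) \<union> ?B"
      then have le: "\<And>i. i < n \<Longrightarrow> \<bar>X i \<omega>\<bar> \<le> real n" and S: "\<bar>S n \<omega>\<bar> < real n * (e / 2)"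
        by (simp_all add: not_less not_le)
      have "(\<Sum>i<n. X i \<omega>) = (\<Sum>i<n. \<tau> n (X i \<omega>))"
        using le by (intro sum.cong) (simp_all add: \<tau>_def)
      also have "\<dots> = S n \<omega> + real n * m n"
        by (simp add: S_def sum_subtractf)
      finally have "(\<Sum>i<n. X i \<omega>) / real n = S n \<omega> / real n + m n"
        using that(2) by (simp add: add_divide_distrib)
      moreover have "\<bar>S n \<omega> / real n\<bar> < e / 2"
        using S that(2) by (simp add: abs_divide pos_divide_less_eq mult.commute)
      ultimately have "\<bar>(\<Sum>i<n. X i \<omega>) / real n - expectation (X 0)\<bar> < e"
        using that(1) by linarith
      then show False using \<omega> by simp
    qed
    then have "?P n \<le> prob ((\<Union>i<n. ?A i) \<union> ?B)"
      by (intro finite_measure_mono) auto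
    also have "\<dots> \<le> prob (\<Union>i<n. ?A i) + prob ?B"
      by (intro measure_Un_le) auto
    finally have P: "?P n \<le> prob (\<Union>i<n. ?A i) + prob ?B" .
    have "prob (\<Union>i<n. ?A i) \<le> (\<Sum>i<n. prob (?A i))"
      by (intro finite_measure_subadditive_finite) auto
    also have "\<dots> = (\<Sum>i<n. prob (?A 0))"
      by (intro sum.cong refl measure_eq_of_distr_eq[OF distr]) auto
    finally have A: "prob (\<Union>i<n. ?A i) \<le> ?a n" by simp
    have "?B = {\<omega> \<in> space M. (real n * (e / 2))\<^sup>2 \<le> (S n \<omega>)\<^sup>2}"
      using \<open>0 < e\<close> abs_le_square_iff[of "real n * (e / 2)"] by simp
    then have "prob ?B = prob {\<omega> \<in> space M. (real n * (e / 2))\<^sup>2 \<le> (S n \<omega>)\<^sup>2}"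
      by simp
    also have "\<dots> \<le> expectation (\<lambda>\<omega>. (S n \<omega>)\<^sup>2) / (real n * (e / 2))\<^sup>2"
      using S_sq(1)[of n] \<open>0 < e\<close> that(2) by (intro integral_Markov_inequality_measure[where A = "{}"]) auto
    also have "\<dots> \<le> (real n * expectation (\<lambda>\<omega>. (\<tau> n (X 0 \<omega>))\<^sup>2)) / (real n * (e / 2))\<^sup>2"
      by (intro divide_right_mono S_sq) simp
    also have "\<dots> = ?b n"
      using that(2) \<open>0 < e\<close> by (simp add: power2_eq_square ac_simps)
    finally show ?thesis using P A by linarith
  qed
  have "eventually (\<lambda>n. \<bar>m n - expectation (X 0)\<bar> < e / 2) sequentially"
    using tendstoD[OF m_lim, of "e / 2"] \<open>0 < e\<close> by (simp add: dist_real_def)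
  then have "eventually (\<lambda>n. ?P n \<le> ?a n + ?b n) sequentially"
    using eventually_gt_at_top[of 0] by eventually_elim (rule bound)
  then show ?thesis
    by (intro tendsto_sandwich[OF _ _ tendsto_const ab]) auto
qed

end

section \<open>Convergence of Laplace transforms\<close>

text \<open>Substituting \<open>u = exp (- x)\<close> turns the integer points of the Laplace transform into moments
  on \<open>[0, 1]\<close>, where polynomials are uniformly dense.\<close>

lemma weak_conv_m_Laplace:
  fixes T :: "nat \<Rightarrow> 'a \<Rightarrow> real" and \<mu> :: "real measure"
  assumes "prob_space M" and \<mu>: "real_distribution \<mu>"
    and T: "\<And>n. T n \<in> borel_measurable M"
    and T_nonneg: "\<And>n \<omega>. \<omega> \<in> space M \<Longrightarrow> 0 \<le> T n \<omega>"
    and \<mu>_nonneg: "AE x in \<mu>. 0 \<le> x"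
    and Laplace: "\<And>k::nat. (\<lambda>n. \<integral>\<omega>. exp (- real k * T n \<omega>) \<partial>M) \<longlonglongrightarrow> (\<integral>x. exp (- real k * x) \<partial>\<mu>)"
  shows "weak_conv_m (\<lambda>n. distr M borel (T n)) \<mu>"
proof (rule integral_cts_step_conv_imp_weak_conv)
  interpret prob_space M by fact
  interpret \<mu>: real_distribution \<mu> by fact
  show "real_distribution (distr M borel (T n))" for n
    by (rule real_distribution_distr) (rule T)
  show "real_distribution \<mu>" by fact
  fix x y :: real assume "x < y"
  \<comment> \<open>The test function after the substitution \<open>u = exp (- x)\<close>. The value
    0 at the origin makes it continuous there, since \<open>cts_step x y\<close> vanishes to the
    right of \<open>y\<close>.\<close>
  define f where "f u = (if u \<le> 0 then 0 else cts_step x y (- ln u))" for u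
  have f_exp: "cts_step x y z = f (exp (- z))" for z by (simp add: f_def)
  have cts[measurable]: "cts_step x y \<in> borel_measurable borel"
    using cts_step_uniformly_continuous[OF \<open>x < y\<close>, THEN uniformly_continuous_imp_continuous]
    by (rule borel_measurable_continuous_onI)
  have cts_bound: "\<bar>cts_step x y z\<bar> \<le> 1" for z
    using \<open>x < y\<close> by (auto simp: cts_step_def)
  have "continuous_on {0..1} f"
  proof -
    have "continuous_on {0<..} (\<lambda>u. cts_step x y (- ln u))"
      by (intro continuous_on_compose2[OF uniformly_continuous_imp_continuous[OF
              cts_step_uniformly_continuous[OF \<open>x < y\<close>]]] continuous_intros) auto
    then have pos: "continuous_on {0<..} f"
      by (rule continuous_on_eq) (simp add: f_def)
    have "0 = f u" if "u \<in> {..<exp (- y)}" for u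
    proof (cases "0 < u")
      case True
      then have "ln u < - y" using that by (metis lessThan_iff ln_exp ln_less_cancel_iff exp_gt_zero)
      then show ?thesis using \<open>x < y\<close> True by (auto simp: f_def cts_step_def)
    qed (simp add: f_def)
    then have zero: "continuous_on {..<exp (- y)} f"
      by (rule continuous_on_eq[OF continuous_on_const])
    have "{0<..} \<union> {..<exp (- y)} = (UNIV :: real set)"
    proof -
      have "u \<in> {0<..} \<union> {..<exp (- y)}" for u :: real
        using exp_gt_zero[of "- y"] by (cases "0 < u") (simp, simp del: exp_gt_zero)
      then show ?thesis by blast
    qed
    with continuous_on_open_Un[OF open_greaterThan open_lessThan pos zero]
    have "continuous_on UNIV f" by (simp only:)
    then show ?thesis by (rule continuous_on_subset) simp
  qed
  show "(\<lambda>n. integral\<^sup>L (distr M borel (T n)) (cts_step x y)) \<longlonglongrightarrow> integral\<^sup>L \<mu> (cts_step x y)"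
  proof (rule LIMSEQ_I)
    fix e :: real assume "0 < e"
    then obtain g where "real_polynomial_function g" and g: "\<And>u. u \<in> {0..1} \<Longrightarrow> \<bar>f u - g u\<bar> < e / 3"
      using Stone_Weierstrass_real_polynomial_function[OF compact_Icc \<open>continuous_on {0..1} f\<close>, of "e / 3"]
      by (metis divide_pos_pos zero_less_numeral)
    then obtain a N where g_eq: "\<And>u. g u = (\<Sum>i\<le>N. a i * u ^ i)"
      unfolding real_polynomial_function_iff_sum by auto
    \<comment> \<open>A polynomial in \<open>exp (- z)\<close> is a finite combination of the
      exponentials whose integrals converge by \<open>Laplace\<close>.\<close>
    have g_exp: "g (exp (- z)) = (\<Sum>i\<le>N. a i * exp (- real i * z))" for z
      by (simp add: g_eq exp_of_nat_mult[symmetric])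
    have [measurable]: "g \<in> borel_measurable borel"
      unfolding g_eq[abs_def] by measurable
    have approx: "\<bar>cts_step x y z - g (exp (- z))\<bar> \<le> e / 3" if "0 \<le> z" for z
      unfolding f_exp using that by (intro less_imp_le[OF g]) auto
    have intM: "integrable M (\<lambda>\<omega>. exp (- real i * T n \<omega>))" for i n
      by (rule integrable_const_bound[where B = 1])
        (use T T_nonneg in \<open>auto intro!: AE_I2 mult_nonneg_nonneg\<close>)
    have int\<mu>: "integrable \<mu> (\<lambda>z. exp (- real i * z))" for i
      by (rule \<mu>.integrable_const_bound[where B = 1]) (use \<mu>_nonneg in auto)
    have cM: "integrable M (\<lambda>\<omega>. cts_step x y (T n \<omega>))" for n
      by (rule integrable_const_bound[where B = 1]) (use T cts_bound in auto)
    have c\<mu>: "integrable \<mu> (cts_step x y)"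
      by (rule \<mu>.integrable_const_bound[where B = 1]) (use cts_bound in auto)
    have gM: "integrable M (\<lambda>\<omega>. g (exp (- T n \<omega>)))" for n
      unfolding g_exp by (intro Bochner_Integration.integrable_sum integrable_mult_right intM)
    have g\<mu>: "integrable \<mu> (\<lambda>z. g (exp (- z)))"
      unfolding g_exp by (intro Bochner_Integration.integrable_sum integrable_mult_right int\<mu>)
    have eM: "\<bar>(\<integral>\<omega>. cts_step x y (T n \<omega>) \<partial>M) - (\<integral>\<omega>. g (exp (- T n \<omega>)) \<partial>M)\<bar> \<le> e / 3" for n
    proof -
      have "\<bar>(\<integral>\<omega>. cts_step x y (T n \<omega>) - g (exp (- T n \<omega>)) \<partial>M)\<bar> \<le> (\<integral>\<omega>. e / 3 \<partial>M)"
        using cM gM approx T_nonneg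
        by (intro order_trans[OF integral_abs_bound] integral_mono integrable_abs
            Bochner_Integration.integrable_diff) auto
      then show ?thesis using cM gM by (simp add: prob_space)
    qed
    have e\<mu>: "\<bar>(\<integral>z. cts_step x y z \<partial>\<mu>) - (\<integral>z. g (exp (- z)) \<partial>\<mu>)\<bar> \<le> e / 3"
    proof -
      have "\<bar>(\<integral>z. cts_step x y z - g (exp (- z)) \<partial>\<mu>)\<bar> \<le> (\<integral>z. e / 3 \<partial>\<mu>)"
        using c\<mu> g\<mu> approx \<mu>_nonneg
        by (intro order_trans[OF integral_abs_bound] integral_mono_AE integrable_abs
            Bochner_Integration.integrable_diff) auto
      then show ?thesis using c\<mu> g\<mu> \<mu>.prob_space by simp
    qed
    have "(\<lambda>n. \<integral>\<omega>. g (exp (- T n \<omega>)) \<partial>M) \<longlonglongrightarrow> (\<integral>z. g (exp (- z)) \<partial>\<mu>)"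
      unfolding g_exp using intM int\<mu>
      by (simp add: Bochner_Integration.integral_sum) (intro tendsto_sum tendsto_mult_left Laplace[simplified])
    then obtain n0 where n0: "\<And>n. n \<ge> n0 \<Longrightarrow>
        \<bar>(\<integral>\<omega>. g (exp (- T n \<omega>)) \<partial>M) - (\<integral>z. g (exp (- z)) \<partial>\<mu>)\<bar> < e / 3"
      using LIMSEQ_D[of _ _ "e / 3"] \<open>0 < e\<close> by fastforce
    have "norm (integral\<^sup>L (distr M borel (T n)) (cts_step x y) - integral\<^sup>L \<mu> (cts_step x y)) < e"
      if "n \<ge> n0" for n
    proof -
      have "integral\<^sup>L (distr M borel (T n)) (cts_step x y) = (\<integral>\<omega>. cts_step x y (T n \<omega>) \<partial>M)"
        by (rule integral_distr[OF T]) measurable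
      then show ?thesis
        using eM[of n] e\<mu> n0[OF that] unfolding real_norm_def by linarith
    qed
    then show "\<exists>n0. \<forall>n\<ge>n0. norm (integral\<^sup>L (distr M borel (T n)) (cts_step x y) - integral\<^sup>L \<mu> (cts_step x y)) < e"
      by blast
  qed
qed

section \<open>Gaussian vectors and characteristic functions\<close>

lemma prob_space_std_normal_product: "prob_space (\<Pi>\<^sub>M i\<in>I. std_normal_distribution)"
  by (intro prob_space_PiM prob_space_normal_density) simp

text \<open>The exponential of a sum is a product of functions of single coordinates, so the
  integral factors into one-dimensional normal characteristic functions.\<close>

lemma characteristic_function_std_normal_product:
  fixes v :: "nat \<Rightarrow> real"
  shows "(\<integral>z. iexp (\<Sum>j<q. v j * z j) \<partial>(\<Pi>\<^sub>M i\<in>{..<q}. std_normal_distribution)) =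
    complex_of_real (exp (- (\<Sum>j<q. (v j)\<^sup>2) / 2))"
proof -
  interpret std: real_distribution std_normal_distribution by (rule real_dist_normal_dist)
  interpret product_sigma_finite "\<lambda>_ :: nat. std_normal_distribution"
    by standard
  have "iexp (\<Sum>j<q. v j * z j) = (\<Prod>j<q. iexp (v j * z j))" for z :: "nat \<Rightarrow> real"
    by (simp add: sum_distrib_left flip: exp_sum)
  then have "(\<integral>z. iexp (\<Sum>j<q. v j * z j) \<partial>(\<Pi>\<^sub>M i\<in>{..<q}. std_normal_distribution)) =
      (\<integral>z. (\<Prod>j<q. iexp (v j * z j)) \<partial>(\<Pi>\<^sub>M i\<in>{..<q}. std_normal_distribution))"
    by simp
  also have "\<dots> = (\<Prod>j<q. char std_normal_distribution (v j))"
    unfolding char_def by (intro product_integral_prod std.integrable_iexp) auto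
  also have "\<dots> = complex_of_real (\<Prod>j<q. exp (- (v j)\<^sup>2 / 2))"
    by (simp add: char_std_normal_distribution)
  also have "(\<Prod>j<q. exp (- (v j)\<^sup>2 / 2)) = exp (- (\<Sum>j<q. (v j)\<^sup>2) / 2)"
    by (simp add: exp_sum[symmetric] sum_negf sum_divide_distrib)
  finally show ?thesis .
qed

context prob_space
begin

text \<open>\<open>exp (- (s\<^sup>2 / 2) * \<Sum>\<^sub>j v\<^sub>j\<^sup>2)\<close> is the characteristic function of a standard normal vector
  \<open>z\<close> at \<open>s v\<close>. Interchanging the integrals over \<open>z\<close> and over the sample reduces the Laplace
  transform of a sum of squares to one-dimensional characteristic functions.\<close>

lemma Laplace_sum_squares_tendsto:
  fixes V :: "nat \<Rightarrow> nat \<Rightarrow> 'a \<Rightarrow> real"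
  assumes meas: "\<And>n j. V n j \<in> borel_measurable M"
    and proj: "\<And>c. (\<lambda>n. \<integral>\<omega>. iexp (\<Sum>j<q. c j * V n j \<omega>) \<partial>M) \<longlonglongrightarrow>
      complex_of_real (exp (- (\<Sum>j<q. (c j)\<^sup>2) / 2))"
  shows "(\<lambda>n. \<integral>\<omega>. exp (- (s\<^sup>2 / 2) * (\<Sum>j<q. (V n j \<omega>)\<^sup>2)) \<partial>M) \<longlonglongrightarrow>
    (\<integral>z. exp (- (s\<^sup>2 / 2) * (\<Sum>j<q. (z j)\<^sup>2)) \<partial>(\<Pi>\<^sub>M i\<in>{..<q}. std_normal_distribution))"
proof -
  note [measurable] = meas
  let ?P = "\<Pi>\<^sub>M i\<in>{..<q}. std_normal_distribution"
  have sigma_M: "sigma_finite_measure M" by (rule sigma_finite_measure_axioms)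
  note total = prob_space
  interpret N: prob_space ?P by (rule prob_space_std_normal_product)
  interpret pair_prob_space M ?P ..
  have comp[measurable]: "(\<lambda>z. z j) \<in> borel_measurable ?P" if "j \<in> {..<q}" for j
    using measurable_component_singleton[OF that, of "\<lambda>_. std_normal_distribution"]
    by (simp cong: measurable_cong_sets)
  \<comment> \<open>For fixed \<open>\<omega>\<close> the integral over \<open>z\<close> is the
    Laplace integrand; for fixed \<open>z\<close> the integral over \<open>\<omega>\<close> is
    covered by \<open>proj\<close> with coefficients \<open>s * z j\<close>.\<close>
  define f where "f n \<omega> z = iexp (\<Sum>j<q. (s * z j) * V n j \<omega>)" for n \<omega> z
  have f_eq: "complex_of_real (exp (- (s\<^sup>2 / 2) * (\<Sum>j<q. (V n j \<omega>)\<^sup>2))) = (\<integral>z. f n \<omega> z \<partial>?P)" for n \<omega>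
    using characteristic_function_std_normal_product[where v = "\<lambda>j. s * V n j \<omega>" and q = q]
    by (simp add: f_def power_mult_distrib sum_distrib_left[symmetric] ac_simps)
  have f_meas[measurable]: "(\<lambda>(\<omega>, z). f n \<omega> z) \<in> borel_measurable (M \<Otimes>\<^sub>M ?P)" for n
  proof -
    have "(\<lambda>p. snd p j) \<in> borel_measurable (M \<Otimes>\<^sub>M ?P)" if "j \<in> {..<q}" for j
      using measurable_compose[OF measurable_snd comp[OF that]] .
    moreover have "(\<lambda>p. V n j (fst p)) \<in> borel_measurable (M \<Otimes>\<^sub>M ?P)" for j
      by measurable
    ultimately have "(\<lambda>p. \<Sum>j<q. (s * snd p j) * V n j (fst p)) \<in> borel_measurable (M \<Otimes>\<^sub>M ?P)"
      by (intro borel_measurable_sum borel_measurable_times borel_measurable_const) auto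
    then show ?thesis unfolding f_def case_prod_beta by measurable
  qed
  have norm_f: "norm (f n \<omega> z) = 1" for n \<omega> z
    by (simp add: f_def)
  have int_f: "integrable (M \<Otimes>\<^sub>M ?P) (\<lambda>(\<omega>, z). f n \<omega> z)" for n
    by (rule P.integrable_const_bound[where B = 1]) (auto simp: norm_f f_meas)
  have "(\<lambda>n. \<integral>z. (\<integral>\<omega>. f n \<omega> z \<partial>M) \<partial>?P) \<longlonglongrightarrow>
      (\<integral>z. complex_of_real (exp (- (s\<^sup>2 / 2) * (\<Sum>j<q. (z j)\<^sup>2))) \<partial>?P)"
  proof (rule integral_dominated_convergence[where w = "\<lambda>_. 1"])
    show "(\<lambda>z. \<integral>\<omega>. f n \<omega> z \<partial>M) \<in> borel_measurable ?P" for n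
      using measurable_compose[OF measurable_pair_swap' f_meas[of n]]
      by (intro sigma_finite_measure.borel_measurable_lebesgue_integral[OF sigma_M])
        (simp add: case_prod_beta)
    show "(\<lambda>z. complex_of_real (exp (- (s\<^sup>2 / 2) * (\<Sum>j<q. (z j)\<^sup>2)))) \<in> borel_measurable ?P"
      by measurable
    show "AE z in ?P. (\<lambda>n. \<integral>\<omega>. f n \<omega> z \<partial>M) \<longlonglongrightarrow> complex_of_real (exp (- (s\<^sup>2 / 2) * (\<Sum>j<q. (z j)\<^sup>2)))"
    proof (rule AE_I2)
      fix z
      show "(\<lambda>n. \<integral>\<omega>. f n \<omega> z \<partial>M) \<longlonglongrightarrow> complex_of_real (exp (- (s\<^sup>2 / 2) * (\<Sum>j<q. (z j)\<^sup>2)))"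
        unfolding f_def using proj[of "\<lambda>j. s * z j"]
        by (simp add: power_mult_distrib sum_distrib_left[symmetric])
    qed
    have "norm (\<integral>\<omega>. f n \<omega> z \<partial>M) \<le> 1" for n z
      using integral_norm_bound[of M "\<lambda>\<omega>. f n \<omega> z"] by (simp add: norm_f total)
    then show "AE z in ?P. norm (\<integral>\<omega>. f n \<omega> z \<partial>M) \<le> 1" for n by simp
  qed simp
  moreover have "(\<integral>z. (\<integral>\<omega>. f n \<omega> z \<partial>M) \<partial>?P) =
      complex_of_real (\<integral>\<omega>. exp (- (s\<^sup>2 / 2) * (\<Sum>j<q. (V n j \<omega>)\<^sup>2)) \<partial>M)" for n
    using Fubini_integral[OF int_f[of n]] by (simp only: f_eq[symmetric] integral_complex_of_real)
  ultimately have "(\<lambda>n. complex_of_real (\<integral>\<omega>. exp (- (s\<^sup>2 / 2) * (\<Sum>j<q. (V n j \<omega>)\<^sup>2)) \<partial>M)) \<longlonglongrightarrow>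
    complex_of_real (\<integral>z. exp (- (s\<^sup>2 / 2) * (\<Sum>j<q. (z j)\<^sup>2)) \<partial>?P)"
    by (simp only: integral_complex_of_real)
  then show ?thesis by (simp only: tendsto_of_real_iff)
qed

text \<open>The central limit theorem normalizes by \<open>sqrt (n * \<sigma>\<^sup>2)\<close>;
  evaluating the characteristic functions at the point \<open>\<sigma>\<close> cancels the factor
  \<open>\<sigma>\<close>.\<close>

lemma iid_characteristic_function_tendsto:
  fixes X :: "nat \<Rightarrow> 'a \<Rightarrow> real"
  assumes indep: "indep_vars (\<lambda>_. borel) X UNIV"
    and distr: "\<And>i. distr M borel (X i) = distr M borel (X 0)"
    and mean: "expectation (X 0) = 0"
    and sq: "integrable M (\<lambda>\<omega>. (X 0 \<omega>)\<^sup>2)"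
    and var: "expectation (\<lambda>\<omega>. (X 0 \<omega>)\<^sup>2) = \<sigma>\<^sup>2" and "\<sigma> > 0"
  shows "(\<lambda>n. \<integral>\<omega>. iexp ((\<Sum>i<n. X i \<omega>) / sqrt (real n)) \<partial>M) \<longlonglongrightarrow> complex_of_real (exp (- \<sigma>\<^sup>2 / 2))"
proof -
  have meas[measurable]: "X i \<in> borel_measurable M" for i
    using indep unfolding indep_vars_def2 by simp
  have mean': "expectation (X i) = 0" for i
    using integral_eq_of_distr_eq[OF distr meas meas, of "\<lambda>x. x"] mean by simp
  have sq': "integrable M (\<lambda>\<omega>. (X i \<omega>)\<^sup>2)" for i
    using integrable_eq_of_distr_eq[OF distr meas meas, of "\<lambda>x. x\<^sup>2"] sq by simp
  have var': "expectation (\<lambda>\<omega>. (X i \<omega>)\<^sup>2) = \<sigma>\<^sup>2" for i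
    using integral_eq_of_distr_eq[OF distr meas meas, of "\<lambda>x. x\<^sup>2"] var by simp
  let ?D = "\<lambda>n. distr M borel (\<lambda>\<omega>. (\<Sum>i<n. X i \<omega>) / sqrt (real n * \<sigma>\<^sup>2))"
  have "weak_conv_m ?D std_normal_distribution"
    by (rule central_limit_theorem_zero_mean[OF indep mean' \<open>\<sigma> > 0\<close> sq' _ distr]) (simp add: mean' var')
  then have "(\<lambda>n. char (?D n) \<sigma>) \<longlonglongrightarrow> char std_normal_distribution \<sigma>"
    by (intro levy_continuity1 real_dist_normal_dist real_distribution_distr) auto
  moreover have "char (?D n) \<sigma> = (\<integral>\<omega>. iexp ((\<Sum>i<n. X i \<omega>) / sqrt (real n)) \<partial>M)" for n
    unfolding char_def using \<open>\<sigma> > 0\<close> by (subst integral_distr) (simp_all add: real_sqrt_mult)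
  ultimately show ?thesis by (simp add: char_std_normal_distribution)
qed

end

section \<open>Standardized samples\<close>

lemma borel_measurable_vec_nth[measurable (raw)]:
  fixes f :: "'a \<Rightarrow> real^'q"
  assumes "f \<in> borel_measurable M"
  shows "(\<lambda>x. f x $ j) \<in> borel_measurable M"
  using assms by (rule borel_measurable_continuous_on[rotated]) (intro continuous_intros)

text \<open>The setting after the change of coordinates: with identity covariance no matrix appears
  in the limits. Moments are stated for \<open>w 0\<close> and reach the other indices through the
  common law.\<close>

locale standardized_iid = prob_space +
  fixes w :: "nat \<Rightarrow> 'a \<Rightarrow> real^'q"
  assumes indep: "indep_vars (\<lambda>_. borel) w UNIV"
    and distr: "\<And>i. distr M borel (w i) = distr M borel (w 0)"
    and integrable_component: "\<And>j. integrable M (\<lambda>\<omega>. w 0 \<omega> $ j)"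
    and mean: "\<And>j. expectation (\<lambda>\<omega>. w 0 \<omega> $ j) = 0"
    and integrable_product: "\<And>j k. integrable M (\<lambda>\<omega>. w 0 \<omega> $ j * w 0 \<omega> $ k)"
    and covariance: "\<And>j k. expectation (\<lambda>\<omega>. w 0 \<omega> $ j * w 0 \<omega> $ k) = (if j = k then 1 else 0)"
begin

definition scaled :: "nat \<Rightarrow> 'a \<Rightarrow> nat \<Rightarrow> real^'q" where
  "scaled n \<omega> i = w i \<omega> /\<^sub>R sqrt (real n)"

lemma w_measurable[measurable]: "w i \<in> borel_measurable M"
  using indep unfolding indep_vars_def2 by simp

lemma scaled_measurable[measurable]: "(\<lambda>\<omega>. scaled n \<omega> i) \<in> borel_measurable M"
  unfolding scaled_def by measurable

lemma indep_vars_image: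
  assumes "f \<in> borel_measurable borel"
  shows "indep_vars (\<lambda>_. borel) (\<lambda>i \<omega>. f (w i \<omega>)) UNIV"
  by (rule indep_vars_compose2[OF indep]) (rule assms)

lemma distr_image:
  assumes "f \<in> borel_measurable borel"
  shows "distr M borel (\<lambda>\<omega>. f (w i \<omega>)) = distr M borel (\<lambda>\<omega>. f (w 0 \<omega>))"
  using distr_distr[OF assms w_measurable, of i] distr_distr[OF assms w_measurable, of 0] distr[of i]
  by (simp add: comp_def)

text \<open>Provides the inputs of the one-dimensional limit theorem in the direction
  \<open>c\<close>; the identity covariance collapses the double sum over coordinates.\<close>

lemma projection_moments:
  fixes c :: "real^'q"
  shows "integrable M (\<lambda>\<omega>. c \<bullet> w 0 \<omega>)" "expectation (\<lambda>\<omega>. c \<bullet> w 0 \<omega>) = 0"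
    "integrable M (\<lambda>\<omega>. (c \<bullet> w 0 \<omega>)\<^sup>2)" "expectation (\<lambda>\<omega>. (c \<bullet> w 0 \<omega>)\<^sup>2) = (norm c)\<^sup>2"
proof -
  have eq: "c \<bullet> w 0 \<omega> = (\<Sum>j\<in>UNIV. c $ j * w 0 \<omega> $ j)" for \<omega>
    by (simp add: inner_vec_def)
  show "integrable M (\<lambda>\<omega>. c \<bullet> w 0 \<omega>)" "expectation (\<lambda>\<omega>. c \<bullet> w 0 \<omega>) = 0"
    unfolding eq using integrable_component mean by simp_all
  have sq: "(c \<bullet> w 0 \<omega>)\<^sup>2 = (\<Sum>j\<in>UNIV. \<Sum>k\<in>UNIV. c $ j * c $ k * (w 0 \<omega> $ j * w 0 \<omega> $ k))" for \<omega>
    unfolding eq power2_eq_square sum_product by (intro sum.cong refl) (simp add: ac_simps)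
  show "integrable M (\<lambda>\<omega>. (c \<bullet> w 0 \<omega>)\<^sup>2)"
    unfolding sq by (intro Bochner_Integration.integrable_sum integrable_mult_right integrable_product)
  have "expectation (\<lambda>\<omega>. (c \<bullet> w 0 \<omega>)\<^sup>2) = (\<Sum>j\<in>UNIV. \<Sum>k\<in>UNIV. c $ j * c $ k * (if j = k then 1 else 0))"
    unfolding sq using integrable_product covariance by simp
  also have "\<dots> = (\<Sum>j\<in>UNIV. c $ j * c $ j)"
    by (simp add: if_distrib[of "(*) _"] cong: if_cong)
  finally show "expectation (\<lambda>\<omega>. (c \<bullet> w 0 \<omega>)\<^sup>2) = (norm c)\<^sup>2"
    by (simp add: power2_norm_eq_inner inner_vec_def)
qed

lemma integrable_norm_square: "integrable M (\<lambda>\<omega>. (norm (w 0 \<omega>))\<^sup>2)"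
  unfolding power2_norm_eq_inner inner_vec_def using integrable_product by simp

lemma projection_characteristic_function_tendsto:
  fixes c :: "real^'q"
  shows "(\<lambda>n. \<integral>\<omega>. iexp (c \<bullet> (\<Sum>i<n. scaled n \<omega> i)) \<partial>M) \<longlonglongrightarrow> complex_of_real (exp (- (norm c)\<^sup>2 / 2))"
proof (cases "c = 0")
  \<comment> \<open>The zero direction is treated apart because the central limit theorem needs a
    positive variance, here \<open>(norm c)\<^sup>2\<close>.\<close>
  case True
  then show ?thesis by (simp add: prob_space)
next
  case False
  have meas: "(\<lambda>v. c \<bullet> v) \<in> borel_measurable borel" by measurable
  have "(\<lambda>n. \<integral>\<omega>. iexp ((\<Sum>i<n. c \<bullet> w i \<omega>) / sqrt (real n)) \<partial>M) \<longlonglongrightarrow> complex_of_real (exp (- (norm c)\<^sup>2 / 2))"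
    using False
    by (intro iid_characteristic_function_tendsto indep_vars_image distr_image projection_moments meas) simp
  moreover have "(\<Sum>i<n. c \<bullet> w i \<omega>) / sqrt (real n) = c \<bullet> (\<Sum>i<n. scaled n \<omega> i)" for n \<omega>
    by (simp add: scaled_def inner_sum_right sum_distrib_left divide_inverse mult.commute)
  ultimately show ?thesis by simp
qed

lemma Laplace_norm_square_tendsto:
  "(\<lambda>n. \<integral>\<omega>. exp (- real k * (norm (\<Sum>i<n. scaled n \<omega> i))\<^sup>2) \<partial>M) \<longlonglongrightarrow>
    (\<integral>z. exp (- real k * (\<Sum>j<CARD('q). (z j)\<^sup>2)) \<partial>(\<Pi>\<^sub>M i\<in>{..<CARD('q)}. std_normal_distribution))"
proof -
  \<comment> \<open>The normal product is indexed by the numbers below \<open>CARD('q)\<close>, the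
    vectors by the type \<open>'q\<close>; \<open>h\<close> matches the two.\<close>
  obtain h :: "nat \<Rightarrow> 'q" where h: "bij_betw h {..<CARD('q)} UNIV"
    using ex_bij_betw_nat_finite[of "UNIV :: 'q set"] by (auto simp: atLeast0LessThan)
  define V where "V n j \<omega> = (\<Sum>i<n. scaled n \<omega> i) $ h j" for n j \<omega>
  have V_norm: "(\<Sum>j<CARD('q). (V n j \<omega>)\<^sup>2) = (norm (\<Sum>i<n. scaled n \<omega> i))\<^sup>2" for n \<omega>
    unfolding V_def power2_norm_eq_inner inner_vec_def
    using sum.reindex_bij_betw[OF h, of "\<lambda>l. ((\<Sum>i<n. scaled n \<omega> i) $ l)\<^sup>2"] by (simp add: power2_eq_square)
  \<comment> \<open>The choice \<open>s = sqrt (2 * real k)\<close> makes the rate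
    \<open>s\<^sup>2 / 2\<close> equal to \<open>k\<close>.\<close>
  have "(\<lambda>n. \<integral>\<omega>. exp (- ((sqrt (2 * real k))\<^sup>2 / 2) * (\<Sum>j<CARD('q). (V n j \<omega>)\<^sup>2)) \<partial>M) \<longlonglongrightarrow>
    (\<integral>z. exp (- ((sqrt (2 * real k))\<^sup>2 / 2) * (\<Sum>j<CARD('q). (z j)\<^sup>2))
      \<partial>(\<Pi>\<^sub>M i\<in>{..<CARD('q)}. std_normal_distribution))"
  proof (rule Laplace_sum_squares_tendsto)
    show "V n j \<in> borel_measurable M" for n j
      unfolding V_def sum_component by measurable
    fix c :: "nat \<Rightarrow> real"
    define c' :: "real^'q" where "c' = (\<chi> l. c (inv_into {..<CARD('q)} h l))"
    have c': "c' $ h j = c j" if "j \<in> {..<CARD('q)}" for j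
      using h that by (simp add: c'_def bij_betw_def)
    have "(\<Sum>j<CARD('q). c j * V n j \<omega>) = c' \<bullet> (\<Sum>i<n. scaled n \<omega> i)" for n \<omega>
      unfolding inner_vec_def V_def
      using sum.reindex_bij_betw[OF h, of "\<lambda>l. c' $ l * (\<Sum>i<n. scaled n \<omega> i) $ l"] c' by simp
    moreover have "(\<Sum>j<CARD('q). (c j)\<^sup>2) = (norm c')\<^sup>2"
      unfolding power2_norm_eq_inner inner_vec_def
      using sum.reindex_bij_betw[OF h, of "\<lambda>l. (c' $ l)\<^sup>2"] c' by (simp add: power2_eq_square)
    ultimately show "(\<lambda>n. \<integral>\<omega>. iexp (\<Sum>j<CARD('q). c j * V n j \<omega>) \<partial>M) \<longlonglongrightarrow>
        complex_of_real (exp (- (\<Sum>j<CARD('q). (c j)\<^sup>2) / 2))"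
      using projection_characteristic_function_tendsto[of c'] by simp
  qed
  then show ?thesis by (simp add: V_norm)
qed

section \<open>Tail bounds for the standardized sample\<close>

lemma norm_sum_tail:
  assumes "0 < K"
  shows "prob {\<omega> \<in> space M. K < norm (\<Sum>i<n. scaled n \<omega> i)} \<le> real CARD('q) / K\<^sup>2"
proof (cases "n = 0")
  case True
  then show ?thesis using assms by simp
next
  case False
  \<comment> \<open>Each coordinate is a sum of \<open>n\<close> independent centred terms of
    variance \<open>1 / n\<close>. Adding the second moments gives \<open>CARD('q)\<close>, to which
    Markov's inequality is applied.\<close>
  have component: "integrable M (\<lambda>\<omega>. ((\<Sum>i<n. scaled n \<omega> i) $ j)\<^sup>2)"
    "expectation (\<lambda>\<omega>. ((\<Sum>i<n. scaled n \<omega> i) $ j)\<^sup>2) = 1" for j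
  proof -
    have meas: "(\<lambda>v. axis j 1 \<bullet> v) \<in> borel_measurable (borel :: (real^'q) measure)" by measurable
    have M2: "(\<lambda>x::real. x\<^sup>2) \<in> borel_measurable borel" by measurable
    let ?X = "\<lambda>i \<omega>. axis j 1 \<bullet> w i \<omega>"
    note m = projection_moments[of "axis j 1 :: real^'q"]
    have X: "?X i \<in> borel_measurable M" for i by measurable
    have int: "integrable M (\<lambda>\<omega>. (?X i \<omega>)\<^sup>2)" for i
      using integrable_eq_of_distr_eq[OF distr_image[OF meas, of i] X X M2] m(3) by simp
    have E: "expectation (\<lambda>\<omega>. (?X i \<omega>)\<^sup>2) = 1" for i
      using integral_eq_of_distr_eq[OF distr_image[OF meas, of i] X X M2] m(4) by simp
    have E0: "expectation (?X i) = 0" for i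
      using integral_eq_of_distr_eq[OF distr_image[OF meas, of i] X X, of "\<lambda>x. x"] m(2) by simp
    have eq: "((\<Sum>i<n. scaled n \<omega> i) $ j)\<^sup>2 = (\<Sum>i<n. ?X i \<omega>)\<^sup>2 / real n" for \<omega>
      by (simp add: scaled_def inner_axis' sum_distrib_left[symmetric] power_mult_distrib power_inverse
          divide_inverse mult.commute)
    show "integrable M (\<lambda>\<omega>. ((\<Sum>i<n. scaled n \<omega> i) $ j)\<^sup>2)"
      "expectation (\<lambda>\<omega>. ((\<Sum>i<n. scaled n \<omega> i) $ j)\<^sup>2) = 1"
      unfolding eq using expectation_square_sum_indep[OF indep_vars_image[OF meas] int E0, of n] False
      by (simp_all add: E)
  qed
  have eq: "(norm (\<Sum>i<n. scaled n \<omega> i))\<^sup>2 = (\<Sum>j\<in>UNIV. ((\<Sum>i<n. scaled n \<omega> i) $ j)\<^sup>2)" for \<omega>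
    unfolding power2_norm_eq_inner inner_vec_def by (simp add: power2_eq_square)
  have int: "integrable M (\<lambda>\<omega>. (norm (\<Sum>i<n. scaled n \<omega> i))\<^sup>2)"
    unfolding eq using component by (intro Bochner_Integration.integrable_sum)
  have E: "expectation (\<lambda>\<omega>. (norm (\<Sum>i<n. scaled n \<omega> i))\<^sup>2) = real CARD('q)"
    unfolding eq using component by simp
  have "prob {\<omega> \<in> space M. K < norm (\<Sum>i<n. scaled n \<omega> i)} \<le>
      prob {\<omega> \<in> space M. K\<^sup>2 \<le> (norm (\<Sum>i<n. scaled n \<omega> i))\<^sup>2}"
    using assms by (intro finite_measure_mono) (auto intro: power_mono)
  also have "\<dots> \<le> real CARD('q) / K\<^sup>2"
    unfolding E[symmetric] using assms int
    by (intro integral_Markov_inequality_measure[where A = "{}"]) auto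
  finally show ?thesis .
qed

text \<open>A union bound leaves \<open>n\<close> times the probability that
  \<open>(norm (w 0 \<omega>))\<^sup>2\<close> exceeds \<open>s\<^sup>2 * n\<close>, which vanishes
  because this square is integrable.\<close>

lemma max_norm_tail:
  assumes "0 < s"
  shows "(\<lambda>n. prob (\<Union>i<n. {\<omega> \<in> space M. s < norm (scaled n \<omega> i)})) \<longlonglongrightarrow> 0"
proof (rule tendsto_sandwich[OF _ _ tendsto_const])
  let ?X = "\<lambda>\<omega>. (norm (w 0 \<omega>))\<^sup>2"
  show "(\<lambda>n. real n * prob {\<omega> \<in> space M. s\<^sup>2 * real n < \<bar>?X \<omega>\<bar>}) \<longlonglongrightarrow> 0"
    using assms by (intro tail_probability_integrable integrable_norm_square) simp
  have "prob (\<Union>i<n. {\<omega> \<in> space M. s < norm (scaled n \<omega> i)}) \<le>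
      real n * prob {\<omega> \<in> space M. s\<^sup>2 * real n < \<bar>?X \<omega>\<bar>}" for n
  proof (cases "n = 0")
    case False
    have iff: "s < norm (w i \<omega> /\<^sub>R sqrt (real n)) \<longleftrightarrow> s\<^sup>2 * real n < \<bar>(norm (w i \<omega>))\<^sup>2\<bar>" for i \<omega>
    proof -
      have "s < norm (w i \<omega> /\<^sub>R sqrt (real n)) \<longleftrightarrow> s * sqrt (real n) < norm (w i \<omega>)"
        using False by (simp add: field_simps)
      also have "\<dots> \<longleftrightarrow> (s * sqrt (real n))\<^sup>2 < (norm (w i \<omega>))\<^sup>2"
        using assms abs_le_square_iff[of "norm (w i \<omega>)" "s * sqrt (real n)"] by (simp add: not_le[symmetric])
      finally show ?thesis by (simp add: power_mult_distrib)
    qed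
    have "prob (\<Union>i<n. {\<omega> \<in> space M. s < norm (scaled n \<omega> i)}) \<le>
        (\<Sum>i<n. prob {\<omega> \<in> space M. s < norm (scaled n \<omega> i)})"
      by (intro finite_measure_subadditive_finite) auto
    also have "\<dots> = (\<Sum>i<n. prob {\<omega> \<in> space M. s\<^sup>2 * real n < \<bar>?X \<omega>\<bar>})"
      unfolding scaled_def iff by (intro sum.cong refl measure_eq_of_distr_eq[OF distr]) auto
    finally show ?thesis by simp
  qed simp
  then show "\<forall>\<^sub>F n in sequentially. prob (\<Union>i<n. {\<omega> \<in> space M. s < norm (scaled n \<omega> i)}) \<le>
      real n * prob {\<omega> \<in> space M. s\<^sup>2 * real n < \<bar>?X \<omega>\<bar>}" by simp
qed simp

text \<open>The matrix \<open>\<Sum>\<^sub>i a\<^sub>i a\<^sub>i\<^sup>T\<close> is kept entry by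
  entry so that the real-valued weak law applies.\<close>

definition gram :: "nat \<Rightarrow> 'a \<Rightarrow> 'q \<Rightarrow> 'q \<Rightarrow> real" where
  "gram n \<omega> j k = (\<Sum>i<n. scaled n \<omega> i $ j * scaled n \<omega> i $ k)"

lemma gram_tail:
  assumes "0 < e"
  shows "(\<lambda>n. prob {\<omega> \<in> space M. e < \<bar>gram n \<omega> j k - (if j = k then 1 else 0)\<bar>}) \<longlonglongrightarrow> 0"
proof -
  have meas: "(\<lambda>v. v $ j * v $ k) \<in> borel_measurable (borel :: (real^'q) measure)" by measurable
  have "gram n \<omega> j k = (\<Sum>i<n. w i \<omega> $ j * w i \<omega> $ k) / real n" for n \<omega>
    unfolding gram_def scaled_def sum_divide_distrib
    by (intro sum.cong refl) (simp add: field_simps)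
  then show ?thesis
    using weak_law_of_large_numbers[OF indep_vars_image[OF meas] distr_image[OF meas] integrable_product assms]
    by (simp add: covariance)
qed

text \<open>A factor \<open>CARD('q)\<close> is lost in summing over a row and another in bounding
  the norm by the sum of the coordinates; the assumed entrywise bound pays for both.\<close>

lemma gram_approx:
  assumes "\<And>j k. \<bar>gram n \<omega> j k - (if j = k then 1 else 0)\<bar> \<le> s / (real CARD('q))\<^sup>2"
  shows "norm ((\<Sum>i<n. (v \<bullet> scaled n \<omega> i) *\<^sub>R scaled n \<omega> i) - v) \<le> s * norm v"
proof -
  let ?u = "(\<Sum>i<n. (v \<bullet> scaled n \<omega> i) *\<^sub>R scaled n \<omega> i) - v"
  let ?q = "real CARD('q)"
  have "\<bar>?u $ j\<bar> \<le> s / ?q * norm v" for j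
  proof -
    have "(\<Sum>k\<in>UNIV. (if j = k then 1 else 0) * v $ k) = v $ j"
      by (simp add: mult_delta_left)
    then have "?u $ j = (\<Sum>k\<in>UNIV. gram n \<omega> j k * v $ k) - (\<Sum>k\<in>UNIV. (if j = k then 1 else 0) * v $ k)"
      by (simp add: gram_def inner_vec_def sum_distrib_right sum_distrib_left ac_simps
          sum.swap[of _ _ "{..<n}"])
    also have "\<dots> = (\<Sum>k\<in>UNIV. (gram n \<omega> j k - (if j = k then 1 else 0)) * v $ k)"
      by (simp only: sum_subtractf[symmetric] left_diff_distrib)
    also have "\<bar>\<dots>\<bar> \<le> (\<Sum>k\<in>(UNIV :: 'q set). s / ?q\<^sup>2 * norm v)"
      using order_trans[OF abs_ge_zero assms]
      by (intro order_trans[OF sum_abs] sum_mono)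
        (simp only: abs_mult, intro mult_mono assms component_le_norm_cart abs_ge_zero)
    also have "\<dots> = s / ?q * norm v"
      by (simp add: power2_eq_square)
    finally show ?thesis .
  qed
  then have "norm ?u \<le> (\<Sum>j\<in>(UNIV :: 'q set). s / ?q * norm v)"
    by (intro order_trans[OF norm_le_l1_cart] sum_mono)
  then show ?thesis by simp
qed

text \<open>The bound for a large sum is uniform in \<open>n\<close> and is made small later through
  \<open>K\<close>; the events on the largest vector and on the Gram matrix have vanishing
  probability and share \<open>e\<close>.\<close>

lemma exceptional_events:
  assumes "0 < K" "0 < s" "0 < e"
  obtains Bad where "\<And>n. Bad n \<in> events"
    and "eventually (\<lambda>n. prob (Bad n) < real CARD('q) / K\<^sup>2 + e) sequentially"
    and "\<And>n \<omega>. \<omega> \<in> space M - Bad n \<Longrightarrow> norm (\<Sum>i<n. scaled n \<omega> i) \<le> K \<and>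
      (\<forall>i<n. norm (scaled n \<omega> i) \<le> s) \<and>
      (\<forall>v. norm ((\<Sum>i<n. (v \<bullet> scaled n \<omega> i) *\<^sub>R scaled n \<omega> i) - v) \<le> s * norm v)"
proof -
  let ?q = "real CARD('q)"
  define d where "d = s / ?q\<^sup>2"
  have "0 < d" using assms by (simp add: d_def)
  have [measurable]: "(\<lambda>\<omega>. gram n \<omega> j k) \<in> borel_measurable M" for n j k
    unfolding gram_def by measurable
  let ?A = "\<lambda>n. {\<omega> \<in> space M. K < norm (\<Sum>i<n. scaled n \<omega> i)}"
  let ?B = "\<lambda>n. \<Union>i<n. {\<omega> \<in> space M. s < norm (scaled n \<omega> i)}"
  let ?C = "\<lambda>n j k. {\<omega> \<in> space M. d < \<bar>gram n \<omega> j k - (if j = k then 1 else 0)\<bar>}"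
  define Bad where "Bad n = ?A n \<union> ?B n \<union> (\<Union>j. \<Union>k. ?C n j k)" for n
  have [measurable]: "?A n \<in> events" "?B n \<in> events" "?C n j k \<in> events" for n j k
    by measurable
  have Bad: "Bad n \<in> events" for n unfolding Bad_def by measurable
  have le: "prob (Bad n) \<le> ?q / K\<^sup>2 + (prob (?B n) + (\<Sum>j\<in>UNIV. \<Sum>k\<in>UNIV. prob (?C n j k)))" for n
  proof -
    have "prob (Bad n) \<le> prob (?A n \<union> ?B n) + prob (\<Union>j. \<Union>k. ?C n j k)"
      unfolding Bad_def by (intro measure_Un_le) measurable
    moreover have "prob (?A n \<union> ?B n) \<le> prob (?A n) + prob (?B n)"
      by (intro measure_Un_le) measurable
    moreover have "prob (\<Union>j. \<Union>k. ?C n j k) \<le> (\<Sum>j\<in>UNIV. prob (\<Union>k. ?C n j k))"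
      by (intro measure_UNION_le) (simp, measurable)
    moreover have "(\<Sum>j\<in>UNIV. prob (\<Union>k. ?C n j k)) \<le> (\<Sum>j\<in>UNIV. \<Sum>k\<in>UNIV. prob (?C n j k))"
      by (intro sum_mono measure_UNION_le) (simp, measurable)
    moreover have "prob (?A n) \<le> ?q / K\<^sup>2" by (rule norm_sum_tail[OF \<open>0 < K\<close>])
    ultimately show ?thesis by linarith
  qed
  have "(\<lambda>n. prob (?B n) + (\<Sum>j\<in>UNIV. \<Sum>k\<in>UNIV. prob (?C n j k))) \<longlonglongrightarrow> 0 + (\<Sum>j\<in>(UNIV::'q set). \<Sum>k\<in>(UNIV::'q set). 0)"
    by (intro tendsto_add tendsto_sum max_norm_tail gram_tail \<open>0 < s\<close> \<open>0 < d\<close>)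
  then have "eventually (\<lambda>n. prob (?B n) + (\<Sum>j\<in>UNIV. \<Sum>k\<in>UNIV. prob (?C n j k)) < e) sequentially"
    by (rule order_tendstoD) (simp add: assms)
  then have "eventually (\<lambda>n. prob (Bad n) < ?q / K\<^sup>2 + e) sequentially"
  proof eventually_elim
    case (elim n)
    then show ?case using le[of n] by linarith
  qed
  moreover have "norm (\<Sum>i<n. scaled n \<omega> i) \<le> K \<and> (\<forall>i<n. norm (scaled n \<omega> i) \<le> s) \<and>
      (\<forall>v. norm ((\<Sum>i<n. (v \<bullet> scaled n \<omega> i) *\<^sub>R scaled n \<omega> i) - v) \<le> s * norm v)"
    if "\<omega> \<in> space M - Bad n" for n \<omega>
  proof (intro conjI allI impI gram_approx)
    show "norm (\<Sum>i<n. scaled n \<omega> i) \<le> K"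
      using that unfolding Bad_def by (simp add: not_less)
    show "norm (scaled n \<omega> i) \<le> s" if "i < n" for i
      using that \<open>\<omega> \<in> space M - Bad n\<close> unfolding Bad_def by (simp add: not_less)
    show "\<bar>gram n \<omega> j k - (if j = k then 1 else 0)\<bar> \<le> s / (real CARD('q))\<^sup>2" for j k
      using that unfolding Bad_def d_def[symmetric] by (simp add: not_less)
  qed
  ultimately show ?thesis using Bad that by blast
qed

end

section \<open>Empirical weights and the statistic\<close>

text \<open>Stated for arbitrary vectors in place of scores, so that the equation can be studied
  under linear maps.\<close>

definition el_root :: "nat \<Rightarrow> (nat \<Rightarrow> real^'q) \<Rightarrow> real^'q \<Rightarrow> bool" where
  "el_root n g t \<longleftrightarrow>
     (1 / real n) *\<^sub>R (\<Sum>i<n. (1 / (1 + t \<bullet> g i)) *\<^sub>R g i) = 0 \<and> (\<forall>i<n. 1 + t \<bullet> g i \<ge> 1 / real n)"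

definition el_unique_root :: "nat \<Rightarrow> (nat \<Rightarrow> real^'q) \<Rightarrow> real^'q" where
  "el_unique_root n g = (if \<exists>!t. el_root n g t then (THE t. el_root n g t) else 0)"

definition el_statistic :: "(real \<Rightarrow> real) \<Rightarrow> nat \<Rightarrow> (nat \<Rightarrow> real^'q) \<Rightarrow> real" where
  "el_statistic \<phi> n g = 2 / deriv (deriv \<phi>) 1 *
     (\<Sum>i<n. 1 / (1 + el_unique_root n g \<bullet> g i) * \<phi> (1 + el_unique_root n g \<bullet> g i))"

lemma el_multiplier_eq: "el_multiplier n xs ys \<beta> = el_unique_root n (\<lambda>i. score (xs i) (ys i) \<beta>)"
proof -
  have "el_equation n xs ys \<beta> = el_root n (\<lambda>i. score (xs i) (ys i) \<beta>)"
    by (simp add: fun_eq_iff el_equation_def el_root_def)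
  then show ?thesis by (simp add: el_multiplier_def el_unique_root_def)
qed

text \<open>A root satisfies the lower bound \<open>1 / n\<close>, and the default multiplier 0
  gives the value 1.\<close>

lemma el_unique_root_pos:
  assumes "i < n"
  shows "0 < 1 + el_unique_root n g \<bullet> g i"
proof (cases "\<exists>!t. el_root n g t")
  case True
  then have "el_root n g (el_unique_root n g)"
    unfolding el_unique_root_def by (simp add: theI')
  then have "1 / real n \<le> 1 + el_unique_root n g \<bullet> g i"
    using assms by (simp add: el_root_def)
  moreover have "0 < 1 / real n" using assms by simp
  ultimately show ?thesis by linarith
qed (simp add: el_unique_root_def)

text \<open>The weights are positive, so every term takes the finite branch of
  \<open>phi_term\<close>; the factors \<open>n\<close> and \<open>1 / n\<close> cancel, and for
  \<open>n = 0\<close> both sides are 0.\<close>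

lemma phi_statistic_eq: "phi_statistic \<phi> n xs ys \<beta> = el_statistic \<phi> n (\<lambda>i. score (xs i) (ys i) \<beta>)"
proof -
  let ?g = "\<lambda>i. score (xs i) (ys i) \<beta>"
  define t where "t = el_unique_root n ?g"
  have summand: "phi_term \<phi> (1 / real n) (el_weight n xs ys \<beta> i) =
      ereal (1 / real n * (1 / (1 + t \<bullet> ?g i) * \<phi> (1 + t \<bullet> ?g i)))" if "i < n" for i
  proof -
    have weight: "el_weight n xs ys \<beta> i = 1 / real n * (1 / (1 + t \<bullet> ?g i))"
      by (simp add: el_weight_def el_multiplier_eq t_def)
    moreover have pos: "0 < 1 + t \<bullet> ?g i"
      unfolding t_def using that by (rule el_unique_root_pos)
    moreover have "1 / real n / el_weight n xs ys \<beta> i = 1 + t \<bullet> ?g i"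
      unfolding weight using that pos by simp
    ultimately show ?thesis
      unfolding phi_term_def using that by simp
  qed
  have "phi_divergence n \<phi> (\<lambda>_. 1 / real n) (el_weight n xs ys \<beta>) =
      ereal (1 / real n * (\<Sum>i<n. 1 / (1 + t \<bullet> ?g i) * \<phi> (1 + t \<bullet> ?g i)))"
    unfolding phi_divergence_def by (simp add: summand sum_distrib_left)
  then show ?thesis
    unfolding phi_statistic_def el_statistic_def t_def[symmetric] by (cases "n = 0") simp_all
qed

lemma el_statistic_nonneg:
  assumes "\<phi> \<in> Phi"
  shows "0 \<le> el_statistic \<phi> n g"
proof -
  have "0 \<le> 1 / (1 + el_unique_root n g \<bullet> g i) * \<phi> (1 + el_unique_root n g \<bullet> g i)" if "i < n" for i
    using el_unique_root_pos[OF that, of g] by (intro mult_nonneg_nonneg Phi_nonneg[OF assms]) simp_all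
  moreover have "0 < deriv (deriv \<phi>) 1"
    using assms by (simp add: Phi_def Phi_star_def)
  ultimately show ?thesis
    unfolding el_statistic_def by (intro mult_nonneg_nonneg[of "2 / _"] sum_nonneg[of "{..<n}"]) simp_all
qed

text \<open>The roots are exhibited as the zeros of a nonnegative function, continuous in
  \<open>t\<close> and measurable in \<open>\<omega>\<close>, to which the selection of unique zeros
  applies with the same default 0.\<close>

lemma borel_measurable_el_unique_root:
  fixes g :: "nat \<Rightarrow> 'a \<Rightarrow> real^'q"
  assumes meas: "\<And>i. g i \<in> borel_measurable M"
  shows "(\<lambda>\<omega>. el_unique_root n (\<lambda>i. g i \<omega>)) \<in> borel_measurable M"
proof -
  note [measurable] = meas
  \<comment> \<open>The denominators are bounded below by \<open>1 / n\<close> at a root, so truncating them there does not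
    change the zeros but makes the function continuous.\<close>
  define F where "F t \<omega> = norm (\<Sum>i<n. (1 / max (1 / real n) (1 + t \<bullet> g i \<omega>)) *\<^sub>R g i \<omega>)
      + (\<Sum>i<n. max 0 (1 / real n - (1 + t \<bullet> g i \<omega>)))" for t \<omega>
  have zero: "F t \<omega> = 0 \<longleftrightarrow> el_root n (\<lambda>i. g i \<omega>) t" for t \<omega>
  proof -
    have "F t \<omega> = 0 \<longleftrightarrow> (\<Sum>i<n. (1 / max (1 / real n) (1 + t \<bullet> g i \<omega>)) *\<^sub>R g i \<omega>) = 0 \<and>
        (\<Sum>i<n. max 0 (1 / real n - (1 + t \<bullet> g i \<omega>))) = 0"
      unfolding F_def by (subst add_nonneg_eq_0_iff) (simp_all add: sum_nonneg)
    also have "(\<Sum>i<n. max 0 (1 / real n - (1 + t \<bullet> g i \<omega>))) = 0 \<longleftrightarrow> (\<forall>i<n. 1 / real n \<le> 1 + t \<bullet> g i \<omega>)"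
    proof -
      have "max 0 (1 / real n - x) = 0 \<longleftrightarrow> 1 / real n \<le> x" for x by (auto simp: max_def)
      then show ?thesis by (subst sum_nonneg_eq_0_iff) auto
    qed
    also have "((\<Sum>i<n. (1 / max (1 / real n) (1 + t \<bullet> g i \<omega>)) *\<^sub>R g i \<omega>) = 0 \<and>
          (\<forall>i<n. 1 / real n \<le> 1 + t \<bullet> g i \<omega>)) \<longleftrightarrow>
        ((\<Sum>i<n. (1 / (1 + t \<bullet> g i \<omega>)) *\<^sub>R g i \<omega>) = 0 \<and> (\<forall>i<n. 1 / real n \<le> 1 + t \<bullet> g i \<omega>))"
      by (intro rev_conj_cong refl arg_cong[where f = "\<lambda>x. x = 0"] sum.cong) (simp add: max_absorb2)
    finally show ?thesis
      unfolding el_root_def by (cases "n = 0") auto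
  qed
  have F_meas: "F t \<in> borel_measurable M" for t
    unfolding F_def[abs_def] by measurable
  have F_cont: "continuous_on UNIV (\<lambda>t. F t \<omega>)" for \<omega>
  proof -
    have "max (1 / real n) (1 + t \<bullet> g i \<omega>) \<noteq> 0" if "i < n" for t i
    proof -
      have "0 < 1 / real n" using that by simp
      then have "0 < max (1 / real n) (1 + t \<bullet> g i \<omega>)"
        unfolding less_max_iff_disj by (rule disjI1)
      then show ?thesis by simp
    qed
    then show ?thesis
      unfolding F_def by (intro continuous_intros) auto
  qed
  have "0 \<le> F t \<omega>" for t \<omega>
    unfolding F_def by (intro add_nonneg_nonneg sum_nonneg) auto
  then show ?thesis
    using borel_measurable_unique_zero[OF F_meas F_cont] unfolding el_unique_root_def zero by simp
qed

lemma borel_measurable_el_statistic: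
  fixes g :: "nat \<Rightarrow> 'a \<Rightarrow> real^'q"
  assumes \<phi>: "\<phi> \<in> Phi" and meas: "\<And>i. g i \<in> borel_measurable M"
  shows "(\<lambda>\<omega>. el_statistic \<phi> n (\<lambda>i. g i \<omega>)) \<in> borel_measurable M"
proof -
  note [measurable] = meas borel_measurable_el_unique_root[OF meas]
  \<comment> \<open>Membership in \<open>Phi\<close> constrains \<open>\<phi>\<close> on the
    positive half-line, so the extension by 0 is used for measurability; all arguments that occur
    are positive.\<close>
  define \<psi> where "\<psi> x = (if x \<in> {0<..} then \<phi> x else 0)" for x
  have [measurable]: "\<psi> \<in> borel_measurable borel"
    unfolding \<psi>_def using Phi_continuous_on[OF \<phi>]
    by (intro borel_measurable_continuous_on_if) auto
  have eq: "el_statistic \<phi> n (\<lambda>i. g i \<omega>) = 2 / deriv (deriv \<phi>) 1 *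
      (\<Sum>i<n. 1 / (1 + el_unique_root n (\<lambda>i. g i \<omega>) \<bullet> g i \<omega>) * \<psi> (1 + el_unique_root n (\<lambda>i. g i \<omega>) \<bullet> g i \<omega>))" for \<omega>
    unfolding el_statistic_def
    by (intro arg_cong[where f = "(*) _"] sum.cong refl)
      (simp add: \<psi>_def el_unique_root_pos[of _ n "\<lambda>i. g i \<omega>"])
  show ?thesis unfolding eq by measurable
qed

text \<open>The substitution \<open>t = n\<^sup>-\<^sup>1\<^sup>/\<^sup>2 B \<theta>\<close> carries roots for the standardized vectors
  to roots for the original ones.\<close>

lemma el_unique_root_inner_eq:
  fixes g a :: "nat \<Rightarrow> real^'q" and B C :: "real^'q^'q"
  assumes CB: "C ** B = mat 1" and n: "2 \<le> n"
    and a: "\<And>i. a i = (transpose B *v g i) /\<^sub>R sqrt (real n)"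
    and root: "(\<Sum>i<n. (1 / (1 + \<theta> \<bullet> a i)) *\<^sub>R a i) = 0"
    and half: "\<And>i. i < n \<Longrightarrow> 1 / 2 \<le> 1 + \<theta> \<bullet> a i"
    and nondeg: "\<And>v. (\<And>i. i < n \<Longrightarrow> v \<bullet> a i = 0) \<Longrightarrow> v = 0"
  shows "el_unique_root n g \<bullet> g i = \<theta> \<bullet> a i"
proof -
  have BC: "B ** C = mat 1" by (rule iffD1[OF matrix_left_right_inverse CB])
  have adj: "(B *v u) \<bullet> x = u \<bullet> (transpose B *v x)" for u x
    by (metis dot_lmul_matrix inner_commute transpose_matrix_vector)
  define t where "t = (B *v \<theta>) /\<^sub>R sqrt (real n)"
  have t: "t \<bullet> g i = \<theta> \<bullet> a i" for i
    by (simp add: t_def a adj)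
  have "transpose B *v (\<Sum>i<n. (1 / (1 + t \<bullet> g i)) *\<^sub>R g i) =
      (\<Sum>i<n. (1 / (1 + t \<bullet> g i)) *\<^sub>R (transpose B *v g i))"
    by (simp only: linear_sum[OF matrix_vector_mul_linear] matrix_vector_mult_scaleR)
  also have "\<dots> = sqrt (real n) *\<^sub>R (\<Sum>i<n. (1 / (1 + \<theta> \<bullet> a i)) *\<^sub>R a i)"
    unfolding t scaleR_sum_right using n by (intro sum.cong refl) (simp add: a)
  \<comment> \<open>\<open>transpose C\<close> undoes \<open>transpose B\<close>, so the equation
    for the \<open>a i\<close> yields the one for the \<open>g i\<close>.\<close>
  finally have "transpose C *v (transpose B *v (\<Sum>i<n. (1 / (1 + t \<bullet> g i)) *\<^sub>R g i)) = 0"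
    by (simp only: root scaleR_zero_right matrix_vector_mult_0_right)
  then have "(\<Sum>i<n. (1 / (1 + t \<bullet> g i)) *\<^sub>R g i) = 0"
    unfolding matrix_vector_mul_assoc matrix_transpose_mul[symmetric] BC by simp
  moreover have "1 / real n \<le> 1 + t \<bullet> g i" if "i < n" for i
  proof -
    \<comment> \<open>Here \<open>2 \<le> n\<close> lets the bound 1/2 imply the constraint
      \<open>1 / n\<close>.\<close>
    have "1 / real n \<le> 1 / 2" using n by simp
    then show ?thesis using half[OF that] t[of i] by linarith
  qed
  ultimately have root_t: "el_root n g t" by (simp add: el_root_def)
  have unique: "t' = t" if "el_root n g t'" for t'
  proof -
    have pos: "0 < 1 + s \<bullet> g i" if "el_root n g s" "i < n" for s i
    proof -
      have "1 / real n \<le> 1 + s \<bullet> g i" using that by (simp add: el_root_def)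
      moreover have "0 < 1 / real n" using n by simp
      ultimately show ?thesis by linarith
    qed
    have sum0: "(\<Sum>i<n. (1 / (1 + s \<bullet> g i)) *\<^sub>R g i) = 0" if "el_root n g s" for s
      using that n by (simp add: el_root_def)
    \<comment> \<open>Pairing the difference of the two equations with \<open>t' - t\<close> gives a
      vanishing sum of these nonnegative terms, so \<open>t' - t\<close> is orthogonal to every
      \<open>g i\<close>.\<close>
    let ?d = "\<lambda>i. ((t' - t) \<bullet> g i)\<^sup>2 / ((1 + t \<bullet> g i) * (1 + t' \<bullet> g i))"
    have "(\<Sum>i<n. ?d i) = (t' - t) \<bullet> ((\<Sum>i<n. (1 / (1 + t \<bullet> g i)) *\<^sub>R g i) - (\<Sum>i<n. (1 / (1 + t' \<bullet> g i)) *\<^sub>R g i))"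
      unfolding sum_subtractf[symmetric] inner_sum_right
    proof (intro sum.cong refl)
      fix i assume "i \<in> {..<n}"
      then have "1 + t \<bullet> g i \<noteq> 0" "1 + t' \<bullet> g i \<noteq> 0"
        using pos[OF root_t, of i] pos[OF that, of i] by simp_all
      then show "?d i = (t' - t) \<bullet> ((1 / (1 + t \<bullet> g i)) *\<^sub>R g i - (1 / (1 + t' \<bullet> g i)) *\<^sub>R g i)"
        by (simp add: inner_diff_left inner_diff_right divide_simps) (simp add: power2_eq_square algebra_simps)
    qed
    also have "\<dots> = 0" by (simp add: sum0[OF root_t] sum0[OF that])
    finally have "(\<Sum>i<n. ?d i) = 0" .
    moreover have "0 \<le> ?d i" if "i < n" for i
      using pos[OF root_t that] pos[OF \<open>el_root n g t'\<close> that] by simp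
    ultimately have "?d i = 0" if "i < n" for i
      using that by (subst (asm) sum_nonneg_eq_0_iff) auto
    then have orth: "(t' - t) \<bullet> g i = 0" if "i < n" for i
      using that pos[OF root_t, of i] pos[OF \<open>el_root n g t'\<close>, of i] by fastforce
    \<comment> \<open>Non-degeneracy is assumed in the coordinates of the \<open>a i\<close>, so
      \<open>t' - t\<close> is carried there by \<open>C\<close>.\<close>
    have "(C *v (t' - t)) \<bullet> a i = 0" if "i < n" for i
    proof -
      have "(C *v (t' - t)) \<bullet> (transpose B *v g i) = ((B ** C) *v (t' - t)) \<bullet> g i"
        unfolding matrix_vector_mul_assoc[symmetric] adj ..
      then show ?thesis using orth[OF that] by (simp add: BC a)
    qed
    then have "C *v (t' - t) = 0" by (rule nondeg)
    then have "B *v (C *v (t' - t)) = 0" by simp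
    then show "t' = t" unfolding matrix_vector_mul_assoc BC by simp
  qed
  have ex1: "\<exists>!t. el_root n g t" using root_t unique by (rule ex1I)
  have "(THE t. el_root n g t) = t" using ex1 root_t by (rule the1_equality)
  then have "el_unique_root n g = t" by (simp add: el_unique_root_def ex1)
  then show ?thesis using t by simp
qed

section \<open>From Laplace transforms to the limit law\<close>

lemma chi_square_distribution_properties:
  "real_distribution (chi_square_distribution q)"
  "AE x in chi_square_distribution q. 0 \<le> x"
  "(\<integral>x. exp (- real k * x) \<partial>(chi_square_distribution q)) =
    (\<integral>z. exp (- real k * (\<Sum>j<q. (z j)\<^sup>2)) \<partial>(\<Pi>\<^sub>M i\<in>{..<q}. std_normal_distribution))"
proof -
  let ?P = "\<Pi>\<^sub>M i\<in>{..<q}. std_normal_distribution"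
  interpret P: prob_space ?P by (rule prob_space_std_normal_product)
  have comp: "(\<lambda>z. z j) \<in> borel_measurable ?P" if "j \<in> {..<q}" for j
    using measurable_component_singleton[OF that, of "\<lambda>_. std_normal_distribution"]
    by (simp cong: measurable_cong_sets)
  then have meas[measurable]: "(\<lambda>z. \<Sum>j<q. (z j)\<^sup>2) \<in> borel_measurable ?P"
    by (intro borel_measurable_sum borel_measurable_power)
  show "real_distribution (chi_square_distribution q)"
    unfolding chi_square_distribution_def by (intro P.real_distribution_distr meas)
  show "AE x in chi_square_distribution q. 0 \<le> x"
    unfolding chi_square_distribution_def by (subst AE_distr_iff[OF meas]) (auto intro!: sum_nonneg)
  show "(\<integral>x. exp (- real k * x) \<partial>(chi_square_distribution q)) = (\<integral>z. exp (- real k * (\<Sum>j<q. (z j)\<^sup>2)) \<partial>?P)"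
    unfolding chi_square_distribution_def by (rule integral_distr[OF meas]) measurable
qed

context prob_space
begin

text \<open>On the half-line \<open>exp (- k * x)\<close> is Lipschitz with constant
  \<open>k\<close> and takes values between 0 and 1. The first fact is used where the variables are
  close, the second on the event of small probability where they are not.\<close>

lemma Laplace_asymptotically_equal:
  fixes S T :: "nat \<Rightarrow> 'a \<Rightarrow> real"
  assumes S[measurable]: "\<And>n. S n \<in> borel_measurable M" and T[measurable]: "\<And>n. T n \<in> borel_measurable M"
    and nonneg: "\<And>n \<omega>. 0 \<le> S n \<omega>" "\<And>n \<omega>. 0 \<le> T n \<omega>"
    and close: "\<And>\<eta> e. 0 < \<eta> \<Longrightarrow> 0 < e \<Longrightarrow> eventually (\<lambda>n. prob {\<omega> \<in> space M. \<eta> < \<bar>T n \<omega> - S n \<omega>\<bar>} < e) sequentially"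
    and lim: "(\<lambda>n. \<integral>\<omega>. exp (- real k * S n \<omega>) \<partial>M) \<longlonglongrightarrow> L"
  shows "(\<lambda>n. \<integral>\<omega>. exp (- real k * T n \<omega>) \<partial>M) \<longlonglongrightarrow> L"
proof -
  have int: "integrable M (\<lambda>\<omega>. exp (- real k * R \<omega>))"
    if [measurable]: "R \<in> borel_measurable M" and "\<And>\<omega>. 0 \<le> R \<omega>" for R :: "'a \<Rightarrow> real"
    by (rule integrable_const_bound[where B = 1]) (auto simp: that)
  note intS = int[OF S nonneg(1)] and intT = int[OF T nonneg(2)]
  have exp_diff: "\<bar>exp (- a) - exp (- b)\<bar> \<le> \<bar>a - b\<bar>" if "0 \<le> a" "0 \<le> b" for a b :: real
  proof -
    have *: "exp (- a) - exp (- b) \<le> b - a" if "0 \<le> a" "a \<le> b" for a b :: real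
    proof -
      have "exp (- a) - exp (- b) = exp (- a) * (1 - exp (a - b))"
        by (simp add: right_diff_distrib exp_add[symmetric])
      also have "\<dots> \<le> 1 * (b - a)"
      proof (rule mult_mono)
        show "1 - exp (a - b) \<le> b - a" using exp_ge_add_one_self[of "a - b"] by linarith
      qed (use that in simp_all)
      finally show ?thesis by simp
    qed
    show ?thesis using *[of a b] *[of b a] that by (cases "a \<le> b") auto
  qed
  have "(\<lambda>n. (\<integral>\<omega>. exp (- real k * T n \<omega>) \<partial>M) - (\<integral>\<omega>. exp (- real k * S n \<omega>) \<partial>M)) \<longlonglongrightarrow> 0"
  proof (rule tendstoI)
    fix e :: real assume "0 < e"
    \<comment> \<open>The denominator uses \<open>k + 1\<close> to allow \<open>k = 0\<close>; the
      other \<open>e / 2\<close> is left for the probability.\<close>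
    define \<eta> where "\<eta> = e / (2 * (real k + 1))"
    have \<eta>: "0 < \<eta>" "real k * \<eta> \<le> e / 2" using \<open>0 < e\<close> by (simp_all add: \<eta>_def field_simps)
    have le: "\<bar>(\<integral>\<omega>. exp (- real k * T n \<omega>) \<partial>M) - (\<integral>\<omega>. exp (- real k * S n \<omega>) \<partial>M)\<bar> \<le>
        real k * \<eta> + prob {\<omega> \<in> space M. \<eta> < \<bar>T n \<omega> - S n \<omega>\<bar>}" for n
    proof -
      let ?A = "{\<omega> \<in> space M. \<eta> < \<bar>T n \<omega> - S n \<omega>\<bar>}"
      have A: "?A \<in> events" by measurable
      have "\<bar>exp (- real k * T n \<omega>) - exp (- real k * S n \<omega>)\<bar> \<le> real k * \<eta> + indicator ?A \<omega>"
        if "\<omega> \<in> space M" for \<omega>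
      proof (cases "\<omega> \<in> ?A")
        case True
        have "0 \<le> exp (- real k * T n \<omega>)" "exp (- real k * T n \<omega>) \<le> 1"
          "0 \<le> exp (- real k * S n \<omega>)" "exp (- real k * S n \<omega>) \<le> 1"
          using nonneg by simp_all
        moreover have "0 \<le> real k * \<eta>" using \<eta>(1) by simp
        ultimately have "\<bar>exp (- real k * T n \<omega>) - exp (- real k * S n \<omega>)\<bar> \<le> real k * \<eta> + 1"
          by linarith
        then show ?thesis using True by simp
      next
        case False
        have "\<bar>exp (- (real k * T n \<omega>)) - exp (- (real k * S n \<omega>))\<bar> \<le> \<bar>real k * T n \<omega> - real k * S n \<omega>\<bar>"
          using nonneg by (intro exp_diff) simp_all
        also have "\<dots> = real k * \<bar>T n \<omega> - S n \<omega>\<bar>"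
          by (simp add: right_diff_distrib[symmetric] abs_mult)
        also have "\<dots> \<le> real k * \<eta>"
          using False that by (intro mult_left_mono) auto
        finally show ?thesis using False by simp
      qed
      then have "\<bar>\<integral>\<omega>. exp (- real k * T n \<omega>) - exp (- real k * S n \<omega>) \<partial>M\<bar> \<le> (\<integral>\<omega>. real k * \<eta> + indicator ?A \<omega> \<partial>M)"
        using A intS intT
        by (intro order_trans[OF integral_abs_bound] integral_mono integrable_abs
            Bochner_Integration.integrable_diff Bochner_Integration.integrable_add) (auto simp: less_top[symmetric])
      also have "\<dots> = real k * \<eta> + prob ?A"
        using A by (subst Bochner_Integration.integral_add) (auto simp: prob_space less_top[symmetric])
      finally show ?thesis by (simp only: Bochner_Integration.integral_diff[OF intT intS])
    qed
    have "eventually (\<lambda>n. prob {\<omega> \<in> space M. \<eta> < \<bar>T n \<omega> - S n \<omega>\<bar>} < e / 2) sequentially"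
      using \<eta>(1) \<open>0 < e\<close> by (intro close) simp_all
    then show "eventually (\<lambda>n. dist ((\<integral>\<omega>. exp (- real k * T n \<omega>) \<partial>M) - (\<integral>\<omega>. exp (- real k * S n \<omega>) \<partial>M)) 0 < e) sequentially"
    proof eventually_elim
      case (elim n)
      then show ?case using le[of n] \<eta>(2) unfolding dist_real_def diff_0_right by linarith
    qed
  qed
  from tendsto_add[OF this lim] show ?thesis by simp
qed

text \<open>Standardization by \<open>B\<close> reduces the statistic to the squared norm of the
  scaled sum up to an error vanishing in probability, and the Laplace transforms of that squared
  norm converge to those of the chi-square law.\<close>

theorem el_statistic_weak_conv:
  fixes g :: "nat \<Rightarrow> 'a \<Rightarrow> real^'q"
  assumes \<phi>: "\<phi> \<in> Phi"
    and indep: "indep_vars (\<lambda>_. borel) g UNIV"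
    and distr: "\<And>i. distr M borel (g i) = distr M borel (g 0)"
    and int: "integrable M (g 0)" and mean: "integral\<^sup>L M (g 0) = 0"
    and int_outer: "integrable M (\<lambda>\<omega>. outer (g 0 \<omega>))"
    and pos_def: "pos_definite (integral\<^sup>L M (\<lambda>\<omega>. outer (g 0 \<omega>)))"
  shows "weak_conv_m (\<lambda>n. distr M borel (\<lambda>\<omega>. el_statistic \<phi> n (\<lambda>i. g i \<omega>))) (chi_square_distribution CARD('q))"
proof -
  define A where "A = integral\<^sup>L M (\<lambda>\<omega>. outer (g 0 \<omega>))"
  obtain B :: "real^'q^'q" where B: "transpose B ** A ** B = mat 1"
    using pos_definite_congruent_identity pos_def unfolding A_def by blast
  have meas[measurable]: "g i \<in> borel_measurable M" for i
    using indep unfolding indep_vars_def2 by simp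
  have B_meas: "(\<lambda>v. transpose B *v v) \<in> borel_measurable borel"
    by (intro borel_measurable_continuous_onI linear_continuous_on matrix_vector_mul_bounded_linear)
  define w where "w i \<omega> = transpose B *v g i \<omega>" for i \<omega>
  have w_component: "w i \<omega> $ j = (\<Sum>l\<in>UNIV. B $ l $ j * g i \<omega> $ l)" for i \<omega> j
    by (simp add: w_def matrix_vector_mult_def transpose_def)
  have g_int: "integrable M (\<lambda>\<omega>. g 0 \<omega> $ l)" "expectation (\<lambda>\<omega>. g 0 \<omega> $ l) = 0" for l
    using integrable_bounded_linear[OF bounded_linear_vec_nth int] integral_bounded_linear[OF bounded_linear_vec_nth int] mean
    by simp_all
  have gg_int: "integrable M (\<lambda>\<omega>. g 0 \<omega> $ l * g 0 \<omega> $ m)"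
    and gg: "expectation (\<lambda>\<omega>. g 0 \<omega> $ l * g 0 \<omega> $ m) = A $ l $ m" for l m
  proof -
    have lin: "bounded_linear (\<lambda>x :: real^'q^'q. x $ l $ m)"
      by (rule bounded_linear_compose[OF bounded_linear_vec_nth bounded_linear_vec_nth])
    show "integrable M (\<lambda>\<omega>. g 0 \<omega> $ l * g 0 \<omega> $ m)"
      using integrable_bounded_linear[OF lin int_outer] by (simp add: outer_def)
    show "expectation (\<lambda>\<omega>. g 0 \<omega> $ l * g 0 \<omega> $ m) = A $ l $ m"
      using integral_bounded_linear[OF lin int_outer] by (simp add: outer_def A_def)
  qed
  have ww: "w 0 \<omega> $ j * w 0 \<omega> $ k =
      (\<Sum>l\<in>UNIV. \<Sum>m\<in>UNIV. B $ l $ j * B $ m $ k * (g 0 \<omega> $ l * g 0 \<omega> $ m))" for \<omega> j k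
    unfolding w_component sum_product by (intro sum.cong refl) (simp add: ac_simps)
  interpret standardized_iid M w
  proof
    show "indep_vars (\<lambda>_. borel) w UNIV"
      unfolding w_def by (rule indep_vars_compose2[OF indep]) (rule B_meas)
    show "distr M borel (w i) = distr M borel (w 0)" for i
      using distr_distr[OF B_meas meas, of i] distr_distr[OF B_meas meas, of 0] distr[of i]
      by (simp add: comp_def w_def[abs_def])
    show "integrable M (\<lambda>\<omega>. w 0 \<omega> $ j)" "expectation (\<lambda>\<omega>. w 0 \<omega> $ j) = 0" for j
      unfolding w_component using g_int by simp_all
    show "integrable M (\<lambda>\<omega>. w 0 \<omega> $ j * w 0 \<omega> $ k)" for j k
      unfolding ww using gg_int by simp
    show "expectation (\<lambda>\<omega>. w 0 \<omega> $ j * w 0 \<omega> $ k) = (if j = k then 1 else 0)" for j k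
    proof -
      \<comment> \<open>The double sum is an entry of the congruence transform of \<open>A\<close>
        by \<open>B\<close>, the identity by choice of \<open>B\<close>.\<close>
      have "expectation (\<lambda>\<omega>. w 0 \<omega> $ j * w 0 \<omega> $ k) = (\<Sum>l\<in>UNIV. \<Sum>m\<in>UNIV. B $ l $ j * B $ m $ k * A $ l $ m)"
        unfolding ww using gg_int by (simp add: gg)
      also have "\<dots> = (transpose B ** A ** B) $ j $ k"
        by (subst sum.swap)
          (simp add: matrix_matrix_mult_def transpose_def sum_distrib_right sum_distrib_left ac_simps)
      finally show ?thesis by (simp add: B mat_def)
    qed
  qed
  let ?T = "\<lambda>n \<omega>. el_statistic \<phi> n (\<lambda>i. g i \<omega>)"
  let ?S = "\<lambda>n \<omega>. (norm (\<Sum>i<n. scaled n \<omega> i))\<^sup>2"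
  have T[measurable]: "?T n \<in> borel_measurable M" for n
    by (rule borel_measurable_el_statistic[OF \<phi> meas])
  have S[measurable]: "?S n \<in> borel_measurable M" for n
    by measurable
  have close: "eventually (\<lambda>n. prob {\<omega> \<in> space M. \<eta> < \<bar>?T n \<omega> - ?S n \<omega>\<bar>} < e) sequentially"
    if "0 < \<eta>" "0 < e" for \<eta> e
  proof -
    \<comment> \<open>This makes the tail bound for the scaled sum equal to \<open>e / 2\<close>;
      the other exceptional events receive the second half.\<close>
    define K where "K = sqrt (2 * real CARD('q) / e)"
    have K: "0 < K" "real CARD('q) / K\<^sup>2 = e / 2" using \<open>0 < e\<close> by (simp_all add: K_def)
    obtain s where s: "0 < s" "s < 1" and expansion: "\<forall>n. \<forall>a :: nat \<Rightarrow> real^'q.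
      norm (\<Sum>i<n. a i) \<le> K \<longrightarrow> (\<forall>i<n. norm (a i) \<le> s) \<longrightarrow>
      (\<forall>v. norm ((\<Sum>i<n. (v \<bullet> a i) *\<^sub>R a i) - v) \<le> s * norm v) \<longrightarrow>
      (\<exists>\<theta>. (\<forall>i<n. 1 / 2 \<le> 1 + \<theta> \<bullet> a i) \<and> (\<Sum>i<n. (1 / (1 + \<theta> \<bullet> a i)) *\<^sub>R a i) = 0 \<and>
        \<bar>2 / deriv (deriv \<phi>) 1 * (\<Sum>i<n. 1 / (1 + \<theta> \<bullet> a i) * \<phi> (1 + \<theta> \<bullet> a i)) - (norm (\<Sum>i<n. a i))\<^sup>2\<bar> \<le> \<eta>)"
      using el_statistic_expansion[OF \<phi> \<open>0 < K\<close> \<open>0 < \<eta>\<close>, where 'a = "real^'q"]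
      by (elim exE conjE) (rule that)
    obtain Bad where Bad: "\<And>n. Bad n \<in> events"
      and prob_Bad: "eventually (\<lambda>n. prob (Bad n) < real CARD('q) / K\<^sup>2 + e / 2) sequentially"
      and good: "\<And>n \<omega>. \<omega> \<in> space M - Bad n \<Longrightarrow> norm (\<Sum>i<n. scaled n \<omega> i) \<le> K \<and>
        (\<forall>i<n. norm (scaled n \<omega> i) \<le> s) \<and>
        (\<forall>v. norm ((\<Sum>i<n. (v \<bullet> scaled n \<omega> i) *\<^sub>R scaled n \<omega> i) - v) \<le> s * norm v)"
      using exceptional_events[OF \<open>0 < K\<close> \<open>0 < s\<close>, of "e / 2"] \<open>0 < e\<close> half_gt_zero by blast
    have bound: "\<bar>?T n \<omega> - ?S n \<omega>\<bar> \<le> \<eta>" if "\<omega> \<in> space M - Bad n" "2 \<le> n" for n \<omega>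
    proof -
      let ?a = "scaled n \<omega>"
      note good = good[OF that(1)]
      obtain \<theta> where \<theta>: "\<forall>i<n. 1 / 2 \<le> 1 + \<theta> \<bullet> ?a i" "(\<Sum>i<n. (1 / (1 + \<theta> \<bullet> ?a i)) *\<^sub>R ?a i) = 0"
        and le: "\<bar>2 / deriv (deriv \<phi>) 1 * (\<Sum>i<n. 1 / (1 + \<theta> \<bullet> ?a i) * \<phi> (1 + \<theta> \<bullet> ?a i)) - ?S n \<omega>\<bar> \<le> \<eta>"
        using expansion[THEN spec[of _ n], THEN spec[of _ ?a], THEN mp, THEN mp, THEN mp] good
        by (elim conjE) blast
      have "el_unique_root n (\<lambda>i. g i \<omega>) \<bullet> g i \<omega> = \<theta> \<bullet> ?a i" for i
      \<comment> \<open>By the choice of \<open>B\<close>, the left inverse required here is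
        \<open>transpose B ** A\<close>.\<close>
      proof (rule el_unique_root_inner_eq[OF B that(2) _ \<theta>(2)])
        show "?a i = (transpose B *v g i \<omega>) /\<^sub>R sqrt (real n)" for i
          by (simp add: scaled_def w_def)
        show "1 / 2 \<le> 1 + \<theta> \<bullet> ?a i" if "i < n" for i using \<theta>(1) that by blast
        \<comment> \<open>Orthogonality to all vectors makes the Gram sum vanish, and its closeness
          to \<open>v\<close> forces \<open>v = 0\<close> because \<open>s < 1\<close>.\<close>
        fix v assume "\<And>i. i < n \<Longrightarrow> v \<bullet> ?a i = 0"
        then have "norm v \<le> s * norm v" using good[THEN conjunct2, THEN conjunct2, THEN spec, of v] by simp
        then have "\<not> 0 < norm v" using mult_strict_right_mono[OF s(2), of "norm v"] by linarith
        then show "v = 0" by simp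
      qed
      then show ?thesis using le by (simp add: el_statistic_def)
    qed
    show ?thesis
      using prob_Bad eventually_ge_at_top[of 2]
    proof eventually_elim
      case (elim n)
      have "prob {\<omega> \<in> space M. \<eta> < \<bar>?T n \<omega> - ?S n \<omega>\<bar>} \<le> prob (Bad n)"
        using bound[OF _ elim(2)] by (intro finite_measure_mono Bad subsetI) (force simp: not_le[symmetric])
      then show ?case using elim(1) K(2) by linarith
    qed
  qed
  show ?thesis
  proof (rule weak_conv_m_Laplace[OF prob_space_axioms chi_square_distribution_properties(1) T
        el_statistic_nonneg[OF \<phi>] chi_square_distribution_properties(2)])
    fix k :: nat
    show "(\<lambda>n. \<integral>\<omega>. exp (- real k * ?T n \<omega>) \<partial>M) \<longlonglongrightarrow>
        (\<integral>x. exp (- real k * x) \<partial>(chi_square_distribution CARD('q)))"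
      unfolding chi_square_distribution_properties(3)
      by (rule Laplace_asymptotically_equal[OF S T _ el_statistic_nonneg[OF \<phi>] close Laplace_norm_square_tendsto])
        simp_all
  qed
qed

end

section \<open>Application to the logistic scores\<close>

theorem theorem2:
  fixes M :: "'a measure"
    and X :: "'a \<Rightarrow> real^'q" and Y :: "'a \<Rightarrow> real"
    and Xs :: "nat \<Rightarrow> 'a \<Rightarrow> real^'q" and Ys :: "nat \<Rightarrow> 'a \<Rightarrow> real"
    and \<beta>0 :: "real^'q"
  assumes "prob_space M"
    and "logistic_model M X Y \<beta>0"
    and "iid_copies M X Y Xs Ys"
    and "tending_to_certainty M (\<lambda>n \<omega>. full_rank_design n (\<lambda>i. Xs i \<omega>))"
    and C1: "cond_C1 M X Y \<beta>0"
    and C2: "tending_to_certainty M (\<lambda>n \<omega>. cond_C2 n (\<lambda>i. Xs i \<omega>) (\<lambda>i. Ys i \<omega>) \<beta>0)"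
    and C3: "tending_to_certainty M (\<lambda>n \<omega>. cond_C3 n (\<lambda>i. Xs i \<omega>) (\<lambda>i. Ys i \<omega>) \<beta>0)"
    and C4: "cond_C4 M X Y \<beta>0"
    and C5: "cond_C5 M X Y \<beta>0"
    and C6: "cond_C6 M X Y \<beta>0"
    and C7: "cond_C7 M X Y \<beta>0"
    and C8: "cond_C8 M X Y \<beta>0"
    and C9: "cond_C9 M X Y \<beta>0"
  shows "\<forall>\<phi>\<in>Phi.
    (\<forall>n. \<forall>\<omega>\<in>space M.
       phi_statistic \<phi> n (\<lambda>i. Xs i \<omega>) (\<lambda>i. Ys i \<omega>) \<beta>0 =
       (let t = el_multiplier n (\<lambda>i. Xs i \<omega>) (\<lambda>i. Ys i \<omega>) \<beta>0;
            g = (\<lambda>i. score (Xs i \<omega>) (Ys i \<omega>) \<beta>0)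
        in 2 / deriv (deriv \<phi>) 1 * (\<Sum>i<n. 1 / (1 + t \<bullet> g i) * \<phi> (1 + t \<bullet> g i)))) \<and>
    weak_conv_m
      (\<lambda>n. distr M borel (\<lambda>\<omega>. phi_statistic \<phi> n (\<lambda>i. Xs i \<omega>) (\<lambda>i. Ys i \<omega>) \<beta>0))
      (chi_square_distribution CARD('q))"
proof
  fix \<phi> assume \<phi>: "\<phi> \<in> Phi"
  interpret prob_space M by fact
  define g where "g i \<omega> = score (Xs i \<omega>) (Ys i \<omega>) \<beta>0" for i \<omega>
  \<comment> \<open>The score as a Borel function of the pair, so that independence and equality of
    laws pass from the pairs to the scores.\<close>
  define \<gamma> where "\<gamma> p = score (fst p) (snd p) \<beta>0" for p :: "(real^'q) \<times> real"
  have \<gamma>: "\<gamma> \<in> borel_measurable borel"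
  proof -
    have "1 + exp s \<noteq> (0 :: real)" for s
      using exp_gt_zero[of s] by linarith
    then have "continuous_on UNIV \<gamma>"
      unfolding \<gamma>_def score_def logistic_def by (intro continuous_intros) auto
    then show ?thesis by (rule borel_measurable_continuous_onI)
  qed
  have XY: "(\<lambda>\<omega>. (X \<omega>, Y \<omega>)) \<in> borel_measurable M"
    using assms(2) unfolding logistic_model_def by (intro borel_measurable_Pair) auto
  have indep: "indep_vars (\<lambda>_. borel) (\<lambda>i \<omega>. (Xs i \<omega>, Ys i \<omega>)) UNIV"
    and distr: "\<And>i. distr M borel (\<lambda>\<omega>. (Xs i \<omega>, Ys i \<omega>)) = distr M borel (\<lambda>\<omega>. (X \<omega>, Y \<omega>))"
    using assms(3) unfolding iid_copies_def by auto
  have XsYs: "(\<lambda>\<omega>. (Xs i \<omega>, Ys i \<omega>)) \<in> borel_measurable M" for i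
    using indep unfolding indep_vars_def2 by simp
  have g_eq: "g i = (\<lambda>\<omega>. \<gamma> (Xs i \<omega>, Ys i \<omega>))" for i
    by (simp add: g_def \<gamma>_def fun_eq_iff)
  \<comment> \<open>That \<open>\<beta>0\<close> is a root in C1 gives integrability and mean zero
    of the score of \<open>(X, Y)\<close>, and C4 gives its second moments; equality of laws
    transfers both to the sample.\<close>
  have C1': "integrable M (\<lambda>\<omega>. \<gamma> (X \<omega>, Y \<omega>))" "integral\<^sup>L M (\<lambda>\<omega>. \<gamma> (X \<omega>, Y \<omega>)) = 0"
    using C1 unfolding cond_C1_def \<gamma>_def by auto
  have C4': "integrable M (\<lambda>\<omega>. outer (\<gamma> (X \<omega>, Y \<omega>)))"
    "pos_definite (integral\<^sup>L M (\<lambda>\<omega>. outer (\<gamma> (X \<omega>, Y \<omega>))))"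
    using C4 unfolding cond_C4_def \<gamma>_def by auto
  have outer: "(\<lambda>p. outer (\<gamma> p)) \<in> borel_measurable borel"
  proof (rule measurable_compose[OF \<gamma>])
    show "outer \<in> borel_measurable (borel :: (real^'q) measure)"
      unfolding outer_def by (intro borel_measurable_continuous_onI continuous_intros)
  qed
  have "weak_conv_m (\<lambda>n. distr M borel (\<lambda>\<omega>. el_statistic \<phi> n (\<lambda>i. g i \<omega>))) (chi_square_distribution CARD('q))"
  proof (rule el_statistic_weak_conv[OF \<phi>])
    show "indep_vars (\<lambda>_. borel) g UNIV"
      unfolding g_eq[abs_def] by (rule indep_vars_compose2[OF indep]) (rule \<gamma>)
    show "distr M borel (g i) = distr M borel (g 0)" for i
      using distr_distr[OF \<gamma> XsYs, of i] distr_distr[OF \<gamma> XsYs, of 0] distr[of i] distr[of 0]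
      by (simp add: comp_def g_eq)
    show "integrable M (g 0)" "integral\<^sup>L M (g 0) = 0"
      unfolding g_eq using C1' integrable_eq_of_distr_eq[OF distr XsYs XY \<gamma>] integral_eq_of_distr_eq[OF distr XsYs XY \<gamma>]
      by simp_all
    show "integrable M (\<lambda>\<omega>. outer (g 0 \<omega>))" "pos_definite (integral\<^sup>L M (\<lambda>\<omega>. outer (g 0 \<omega>)))"
      unfolding g_eq using C4' integrable_eq_of_distr_eq[OF distr XsYs XY outer] integral_eq_of_distr_eq[OF distr XsYs XY outer]
      by simp_all
  qed
  then show "(\<forall>n. \<forall>\<omega>\<in>space M.
       phi_statistic \<phi> n (\<lambda>i. Xs i \<omega>) (\<lambda>i. Ys i \<omega>) \<beta>0 =
       (let t = el_multiplier n (\<lambda>i. Xs i \<omega>) (\<lambda>i. Ys i \<omega>) \<beta>0;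
            g = (\<lambda>i. score (Xs i \<omega>) (Ys i \<omega>) \<beta>0)
        in 2 / deriv (deriv \<phi>) 1 * (\<Sum>i<n. 1 / (1 + t \<bullet> g i) * \<phi> (1 + t \<bullet> g i)))) \<and>
    weak_conv_m
      (\<lambda>n. distr M borel (\<lambda>\<omega>. phi_statistic \<phi> n (\<lambda>i. Xs i \<omega>) (\<lambda>i. Ys i \<omega>) \<beta>0))
      (chi_square_distribution CARD('q))"
    by (simp add: phi_statistic_eq el_multiplier_eq el_statistic_def g_def Let_def)
qed

end
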